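(* For every connected, closed 2-manifold $M$, there exists a constant $C(M)$ (depending only on $M$) such that for every finite simplicial triangulation $T$ of $M$, $$\xi(T) \leq |V(T)| + C(M).$$ Explicitly, letting $K_M := 18\,(1 + |\chi(M)|)$, where $\chi(M)$ is the Euler--Poincaré characteristic of $M$, one may choose $$C(M) := K_M^2 + 3K_M.$$
   Context: A closed 2-manifold is a compact 2-manifold without boundary. A finite abstract simplicial complex $T$ consists of a finite vertex set $V(T)$ and a collection $\mathcal{S}(T)$ of subsets of $V(T)$ (simplices), closed under taking subsets and containing every singleton $\{v\}$ with $v \in V(T)$. The edge set $E(T)$ is the set of simplices of cardinality 2, and the face set $F(T)$ is the set of simplices of cardinality 3. A (finite simplicial) triangulation $T$ of $M$ is a finite abstract simplicial complex whose geometric realization $|T|$ is homeomorphic to $M$ (generalized or ideal triangulations are not allowed). The Euler--Poincaré characteristic is $\chi(M) = \chi(T) = |V(T)| - |E(T)| + |F(T)|$ for any triangulation $T$ of $M$. A cyclic coloration of a triangulation $T$ is a coloring of the faces (elements of $F(T)$) such that, for each $v \in V(T)$, the faces containing $v$ have pairwise distinct colors; equivalently, any two distinct faces sharing a vertex have different colors. The cyclic chromatic number $\xi(T)$ is the least $k$ such that $T$ admits a cyclic coloration with $k$ colors. *)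

theory Defs
  imports "HOL-Analysis.Analysis"
begin

section \<open>Closed surfaces\<close>

text \<open>Every point of a \<open>two_manifold\<close> has an open neighbourhood homeomorphic to the whole plane,
  so these are the 2-manifolds without boundary.\<close>

definition two_manifold :: "'a topology \<Rightarrow> bool" where
  "two_manifold M \<longleftrightarrow>
     Hausdorff_space M \<and> second_countable M \<and>
     (\<forall>x\<in>topspace M. \<exists>U. openin M U \<and> x \<in> U \<and>
        subtopology M U homeomorphic_space (euclidean :: (real^2) topology))"

definition closed_two_manifold :: "'a topology \<Rightarrow> bool" where
  "closed_two_manifold M \<longleftrightarrow> two_manifold M \<and> compact_space M"


section \<open>Finite abstract simplicial complexes and triangulations\<close>

record 'v abs_complex =
  verts :: "'v set"
  simplices :: "'v set set"

definition finite_abs_complex :: "'v abs_complex \<Rightarrow> bool" where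
  "finite_abs_complex T \<longleftrightarrow>
     finite (verts T) \<and>
     (\<forall>s\<in>simplices T. s \<subseteq> verts T) \<and>
     (\<forall>s\<in>simplices T. \<forall>t. t \<subseteq> s \<longrightarrow> t \<in> simplices T) \<and>
     (\<forall>v\<in>verts T. {v} \<in> simplices T)"

definition edges :: "'v abs_complex \<Rightarrow> 'v set set" where
  "edges T = {s \<in> simplices T. card s = 2}"

definition faces :: "'v abs_complex \<Rightarrow> 'v set set" where
  "faces T = {s \<in> simplices T. card s = 3}"

text \<open>The geometric realization is given by barycentric coordinates, extended by 0 off the vertex
  set. As the vertex set is finite, the product topology induces the Euclidean topology on it.\<close>

definition geom_realization :: "'v abs_complex \<Rightarrow> ('v \<Rightarrow> real) topology" where
  "geom_realization T = subtopology (powertop_real UNIV)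
     {x. (\<forall>v. 0 \<le> x v) \<and> {v. x v \<noteq> 0} \<in> simplices T \<and> (\<Sum>v\<in>verts T. x v) = 1}"

definition triangulates :: "'v abs_complex \<Rightarrow> 'a topology \<Rightarrow> bool" where
  "triangulates T M \<longleftrightarrow> finite_abs_complex T \<and> geom_realization T homeomorphic_space M"


section \<open>Euler characteristic\<close>

definition complex_euler_char :: "'v abs_complex \<Rightarrow> int" where
  "complex_euler_char T = int (card (verts T)) - int (card (edges T)) + int (card (faces T))"

text \<open>The common value of \<open>complex_euler_char\<close> on all triangulations. Vertices in
  \<^typ>\<open>nat\<close> suffice, since every finite complex is isomorphic to one on natural numbers.\<close>

definition euler_char :: "'a topology \<Rightarrow> int" where
  "euler_char M = (THE c. \<exists>T :: nat abs_complex. triangulates T M \<and> complex_euler_char T = c)"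


section \<open>Cyclic colorations\<close>

definition cyclic_coloration :: "'v abs_complex \<Rightarrow> ('v set \<Rightarrow> 'c) \<Rightarrow> bool" where
  "cyclic_coloration T c \<longleftrightarrow> (\<forall>v\<in>verts T. inj_on c {f \<in> faces T. v \<in> f})"

definition cyclic_chromatic_number :: "'v abs_complex \<Rightarrow> nat" where
  "cyclic_chromatic_number T =
     (LEAST k. \<exists>c :: 'v set \<Rightarrow> nat. cyclic_coloration T c \<and> c ` faces T \<subseteq> {..<k})"

end

(* Colouring. Two faces may share a colour iff they are disjoint, so pair up disjoint faces as far as
   possible and let u faces be left over. The leftover faces pairwise intersect; as two vertices lie
   in at most two common faces, more than 18 of them force a common vertex v, and then maximality
   puts v into one face of every pair as well. So v lies in at least (|F| + u) / 2 faces, but it has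
   at most |V| - 1, and |F| = 2 (|V| - chi) gives u <= 2 chi - 2. Hence (|F| + u) / 2 colours suffice,
   which is at most |V| + 9 + |chi|.

   Local structure. That each edge lies in exactly two faces follows from invariance of domain, and
   the dual graph is connected since a surface stays connected when finitely many points are removed.

   Euler characteristic. Counting cochains mod 2 gives 2^(2 - chi) for the order of H^1(T; Z/2). This
   group is a topological invariant by an Alexander-Spanier argument: a simplicial cocycle becomes a
   function of pairs of nearby points, which is transported by the homeomorphism and then summed
   along fine subdivisions of the edges of the other triangulation. *)

theory Submission
  imports Defs "HOL-Library.Z2" "HOL-Library.Function_Algebras"
begin

section \<open>Colouring by pairs of disjoint faces\<close>

text \<open>The threshold 18 is 3 * 6. If a member of the intersecting family misses a vertex
  \<open>w\<close>, at most 6 members pass through \<open>w\<close>, two for each vertex of the one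
  that misses it; and a single face meets every member in one of its three vertices. The same 6
  drives maximality: when both faces of a pair miss \<open>v\<close>, the pair can be broken up and
  each half matched with a different leftover face. The main difficulty is the constant rather than
  the colouring. It may depend on the surface only, and \<open>euler_char\<close> is a definite
  description, which says something only once any two triangulations are known to agree. A
  homeomorphism of realizations need not respect simplices, so cochains cannot be carried along it
  directly; functions of nearby points can, and a point is turned into a vertex by choosing its
  heaviest one. Coefficients mod 2 treat orientable and non-orientable surfaces alike and allow
  cohomology to be measured by the orders of finite groups. Only injectivity on H^1 is established,
  once in each direction; comparing orders then gives equality.\<close>

lemma faceD:
  assumes "f \<in> faces T"
  shows "card f = 3" "f \<in> simplices T" "finite f"
  using assms by (auto simp: faces_def simp flip: card_gt_0_iff intro!: card_ge_0_finite)

lemma edgeD: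
  assumes "e \<in> edges T"
  shows "card e = 2" "e \<in> simplices T" "finite e"
  using assms by (auto simp: edges_def simp flip: card_gt_0_iff intro!: card_ge_0_finite)

lemma simplex_mono:
  assumes "finite_abs_complex T" "s \<in> simplices T" "t \<subseteq> s"
  shows "t \<in> simplices T"
  using assms by (auto simp: finite_abs_complex_def)

lemma simplex_subset_verts:
  assumes "finite_abs_complex T" "s \<in> simplices T"
  shows "s \<subseteq> verts T" "finite s"
  using assms by (auto simp: finite_abs_complex_def intro: finite_subset)

lemma finite_simplices:
  assumes "finite_abs_complex T"
  shows "finite (simplices T)" "finite (faces T)" "finite (edges T)"
proof -
  have "simplices T \<subseteq> Pow (verts T)" "finite (verts T)"
    using assms by (auto simp: finite_abs_complex_def)
  then show "finite (simplices T)"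
    by (meson finite_Pow_iff finite_subset)
  then show "finite (faces T)" "finite (edges T)"
    by (auto simp: faces_def edges_def)
qed

section \<open>Incidence counts when every edge lies in two faces\<close>

definition two_faced :: "'v abs_complex \<Rightarrow> bool" where
  "two_faced T \<longleftrightarrow> (\<forall>e\<in>edges T. card {f \<in> faces T. e \<subseteq> f} = 2)"

lemma card_faces_through_pair:
  assumes T: "finite_abs_complex T" "two_faced T" and "w \<noteq> z"
  shows "card {f \<in> faces T. {w, z} \<subseteq> f} \<le> 2"
proof (cases "{w, z} \<in> edges T")
  case False
  then have "{f \<in> faces T. {w, z} \<subseteq> f} = {}"
    using assms simplex_mono[OF T(1)] by (fastforce simp: edges_def faces_def)
  then show ?thesis by (metis card.empty zero_le)
qed (use T in \<open>simp only: two_faced_def\<close>)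

text \<open>Double counting of edge-face incidences: three edges in each face, two faces at each
  edge.\<close>

lemma card_edges_eq:
  assumes T: "finite_abs_complex T" "two_faced T"
  shows "2 * card (edges T) = 3 * card (faces T)"
proof -
  have "card {e \<in> edges T. e \<subseteq> f} = 3" if f: "f \<in> faces T" for f
  proof -
    have "{e \<in> edges T. e \<subseteq> f} = {e. e \<subseteq> f \<and> card e = 2}"
      using faceD[OF f] simplex_mono[OF T(1)] by (auto simp: edges_def)
    then show ?thesis
      using n_subsets[of f 2] faceD[OF f] by (simp add: numeral_eq_Suc)
  qed
  then have "(\<Sum>e\<in>edges T. card {f \<in> faces T. e \<subseteq> f}) = 3 * card (faces T)"
    using finite_simplices[OF T(1)] by (intro sum_multicount) auto
  then show ?thesis
    using T(2) by (simp add: two_faced_def)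
qed

lemma card_faces_eq:
  assumes T: "finite_abs_complex T" "two_faced T"
  shows "int (card (faces T)) = 2 * (int (card (verts T)) - complex_euler_char T)"
  using card_edges_eq[OF T] by (simp add: complex_euler_char_def)

text \<open>Double counting of the pairs of a face at \<open>v\<close> and a further vertex
  \<open>w\<close> of it: each face supplies two pairs, and each of the |V| - 1 candidates for
  \<open>w\<close> occurs at most twice.\<close>

lemma card_faces_at_vertex:
  assumes T: "finite_abs_complex T" "two_faced T" and v: "v \<in> verts T"
  shows "card {f \<in> faces T. v \<in> f} \<le> card (verts T) - 1"
proof -
  let ?S = "{f \<in> faces T. v \<in> f}"
  have fin: "finite (verts T)"
    using T by (simp add: finite_abs_complex_def)
  have "card {w \<in> verts T - {v}. w \<in> f} = 2" if "f \<in> ?S" for f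
  proof -
    have "{w \<in> verts T - {v}. w \<in> f} = f - {v}"
      using that faceD simplex_subset_verts[OF T(1)] by blast
    then show ?thesis
      using that faceD[of f T] by simp
  qed
  then have "(\<Sum>w\<in>verts T - {v}. card {f \<in> ?S. w \<in> f}) = 2 * card ?S"
    using finite_simplices[OF T(1)] fin by (intro sum_multicount) auto
  moreover have "card {f \<in> ?S. w \<in> f} \<le> 2" if "w \<in> verts T - {v}" for w
  proof -
    have "{f \<in> ?S. w \<in> f} = {f \<in> faces T. {v, w} \<subseteq> f}"
      by auto
    then show ?thesis
      using that card_faces_through_pair[OF T, of v w] by auto
  qed
  then have "(\<Sum>w\<in>verts T - {v}. card {f \<in> ?S. w \<in> f}) \<le> (\<Sum>w\<in>verts T - {v}. 2)"
    by (intro sum_mono)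
  ultimately show ?thesis
    using fin v by (simp add: card_Diff_singleton)
qed

text \<open>A face counted here contains \<open>v\<close> and one of the three vertices of
  \<open>g\<close>, and each of these three pairs lies in at most two faces.\<close>

lemma card_faces_meeting:
  assumes T: "finite_abs_complex T" "two_faced T" and g: "card g = 3" "v \<notin> g"
  shows "card {f \<in> faces T. v \<in> f \<and> f \<inter> g \<noteq> {}} \<le> 6"
proof -
  have fin: "finite g" using g by (auto intro: card_ge_0_finite)
  have "{f \<in> faces T. v \<in> f \<and> f \<inter> g \<noteq> {}} \<subseteq> (\<Union>z\<in>g. {f \<in> faces T. {v, z} \<subseteq> f})"
    by auto
  moreover have "finite (\<Union>z\<in>g. {f \<in> faces T. {v, z} \<subseteq> f})"
    using fin finite_simplices[OF T(1)] by auto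
  ultimately have "card {f \<in> faces T. v \<in> f \<and> f \<inter> g \<noteq> {}} \<le> card (\<Union>z\<in>g. {f \<in> faces T. {v, z} \<subseteq> f})"
    by (simp add: card_mono)
  also have "\<dots> \<le> (\<Sum>z\<in>g. card {f \<in> faces T. {v, z} \<subseteq> f})"
    by (rule card_UN_le[OF fin])
  also have "\<dots> \<le> (\<Sum>z\<in>g. 2)"
    using g card_faces_through_pair[OF T] by (intro sum_mono) metis
  finally show ?thesis using g by simp
qed

text \<open>Without a common vertex every \<open>w\<close> is avoided by some member
  \<open>g\<close>; all members through \<open>w\<close> meet \<open>g\<close>, so there are at most
  6 of them. The three vertices of one member \<open>f0\<close> then account for at most 18
  members.\<close>

lemma pairwise_intersecting_faces_common_vertex:
  assumes T: "finite_abs_complex T" "two_faced T"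
    and X: "X \<subseteq> faces T" "18 < card X" "\<And>f g. f \<in> X \<Longrightarrow> g \<in> X \<Longrightarrow> f \<inter> g \<noteq> {}"
  shows "\<exists>v. \<forall>f\<in>X. v \<in> f"
proof (rule ccontr)
  assume no: "\<not> ?thesis"
  have finX: "finite X" using X(1) finite_simplices[OF T(1)] by (auto intro: finite_subset)
  obtain f0 where f0: "f0 \<in> X" using X(2) by fastforce
  then have f0': "card f0 = 3" "finite f0" using X(1) faceD by blast+
  have le6: "card {f \<in> X. w \<in> f} \<le> 6" for w
  proof -
    obtain g where g: "g \<in> X" "w \<notin> g" using no by blast
    then have "{f \<in> X. w \<in> f} \<subseteq> {f \<in> faces T. w \<in> f \<and> f \<inter> g \<noteq> {}}"
      using X by auto
    then have "card {f \<in> X. w \<in> f} \<le> card {f \<in> faces T. w \<in> f \<and> f \<inter> g \<noteq> {}}"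
      by (intro card_mono) (use finite_simplices[OF T(1)] in auto)
    also have "\<dots> \<le> 6"
      using g X(1) faceD(1) by (intro card_faces_meeting[OF T]) blast+
    finally show ?thesis .
  qed
  have "X \<subseteq> (\<Union>w\<in>f0. {f \<in> X. w \<in> f})"
    using X(3)[OF f0] by blast
  then have "card X \<le> card (\<Union>w\<in>f0. {f \<in> X. w \<in> f})"
    by (intro card_mono) (use f0' finX in auto)
  also have "\<dots> \<le> (\<Sum>w\<in>f0. card {f \<in> X. w \<in> f})"
    by (rule card_UN_le[OF f0'(2)])
  also have "\<dots> \<le> (\<Sum>w\<in>f0. 6)"
    using le6 by (intro sum_mono) auto
  finally show False using f0' X(2) by simp
qed

text \<open>A matching in the disjointness graph of the faces, encoded as an involution whose fixed
  points are the unmatched faces. Its orbits will be the colour classes.\<close>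

definition disjoint_pairing :: "'v set set \<Rightarrow> ('v set \<Rightarrow> 'v set) \<Rightarrow> bool" where
  "disjoint_pairing F \<sigma> \<longleftrightarrow>
     (\<forall>f\<in>F. \<sigma> f \<in> F \<and> \<sigma> (\<sigma> f) = f \<and> (\<sigma> f \<noteq> f \<longrightarrow> \<sigma> f \<inter> f = {}))"

abbreviation unpaired :: "'v set set \<Rightarrow> ('v set \<Rightarrow> 'v set) \<Rightarrow> 'v set set" where
  "unpaired F \<sigma> \<equiv> {f \<in> F. \<sigma> f = f}"

lemma card_orbits_pairing:
  assumes F: "finite F" and \<sigma>: "disjoint_pairing F \<sigma>"
  shows "2 * card ((\<lambda>f. {f, \<sigma> f}) ` F) = card F + card (unpaired F \<sigma>)"
proof -
  let ?U = "unpaired F \<sigma>" and ?P = "{f \<in> F. \<sigma> f \<noteq> f}"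
  let ?o = "\<lambda>f. {f, \<sigma> f}"
  have s: "\<sigma> f \<in> F" "\<sigma> (\<sigma> f) = f" if "f \<in> F" for f
    using \<sigma> that by (auto simp: disjoint_pairing_def)
  have "?o ` F = (\<lambda>f. {f}) ` ?U \<union> ?o ` ?P"
    by (auto simp: image_iff)
  moreover have "(\<lambda>f. {f}) ` ?U \<inter> ?o ` ?P = {}"
    by auto
  ultimately have "card (?o ` F) = card ((\<lambda>f. {f}) ` ?U) + card (?o ` ?P)"
    using F by (simp add: card_Un_disjoint)
  moreover have "card ((\<lambda>f. {f}) ` ?U) = card ?U"
    by (rule card_image) (auto simp: inj_on_def)
  moreover have "2 * card (?o ` ?P) = card (\<Union>(?o ` ?P))"
  proof (rule card_partition)
    show "c1 \<inter> c2 = {}" if c: "c1 \<in> ?o ` ?P" "c2 \<in> ?o ` ?P" "c1 \<noteq> c2" for c1 c2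
    proof -
      obtain f g where fg: "f \<in> ?P" "g \<in> ?P" "c1 = ?o f" "c2 = ?o g" using c by blast
      show ?thesis
      proof (rule ccontr)
        assume "c1 \<inter> c2 \<noteq> {}"
        then have "g = f \<or> g = \<sigma> f \<or> \<sigma> g = f \<or> \<sigma> g = \<sigma> f"
          using fg by blast
        moreover have ff: "\<sigma> (\<sigma> f) = f" "\<sigma> (\<sigma> g) = g"
          using fg s(2) by blast+
        ultimately have "g = f \<or> g = \<sigma> f"
          by metis
        then have "?o f = ?o g"
          using ff(1) by (elim disjE) auto
        then show False using c(3) fg by simp
      qed
    qed
  next
    show "card c = 2" if "c \<in> ?o ` ?P" for c
      using that by (force simp: card_2_iff)
  qed (use F in auto)
  moreover have "\<Union>(?o ` ?P) = ?P"
  proof -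
    have "\<sigma> f \<in> ?P" if "f \<in> ?P" for f using s[of f] that by auto
    then show ?thesis by blast
  qed
  moreover have "card F = card ?U + card ?P"
    using F by (subst card_Un_disjoint[symmetric]) (auto intro: arg_cong[where f=card])
  ultimately show ?thesis by simp
qed

text \<open>The colour of a face is the number of its orbit. Distinct faces in one orbit are
  disjoint, so no vertex sees a colour twice.\<close>

lemma cyclic_chromatic_number_le_pairing:
  assumes T: "finite_abs_complex T" and \<sigma>: "disjoint_pairing (faces T) \<sigma>"
  shows "2 * cyclic_chromatic_number T \<le> card (faces T) + card (unpaired (faces T) \<sigma>)"
proof -
  let ?O = "(\<lambda>f. {f, \<sigma> f}) ` faces T"
  have fin: "finite (faces T)" by (rule finite_simplices[OF T])
  then obtain h where h: "bij_betw h ?O {0..<card ?O}"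
    using ex_bij_betw_finite_nat by blast
  let ?c = "\<lambda>f. h {f, \<sigma> f}"
  have "cyclic_coloration T ?c"
    unfolding cyclic_coloration_def
  proof (intro ballI inj_onI)
    fix v f g assume fg: "f \<in> {f \<in> faces T. v \<in> f}" "g \<in> {f \<in> faces T. v \<in> f}" "?c f = ?c g"
    have "{f, \<sigma> f} = {g, \<sigma> g}"
      by (rule inj_onD[OF bij_betw_imp_inj_on[OF h]]) (use fg in auto)
    then have "g = f \<or> g = \<sigma> f" by auto
    then show "f = g"
      using fg \<sigma> unfolding disjoint_pairing_def by fastforce
  qed
  moreover have "?c ` faces T \<subseteq> {..<card ?O}"
    using bij_betw_imp_surj_on[OF h] by fastforce
  ultimately have "cyclic_chromatic_number T \<le> card ?O"
    unfolding cyclic_chromatic_number_def by (intro Least_le) blast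
  then show ?thesis
    using card_orbits_pairing[OF fin \<sigma>] by linarith
qed

lemma ex_max_pairing:
  assumes "finite F"
  obtains \<sigma> where "disjoint_pairing F \<sigma>"
    "\<And>\<tau>. disjoint_pairing F \<tau> \<Longrightarrow> card (unpaired F \<sigma>) \<le> card (unpaired F \<tau>)"
proof -
  have "disjoint_pairing F id" by (simp add: disjoint_pairing_def)
  from ex_has_least_nat[of "disjoint_pairing F", OF this, of "\<lambda>\<sigma>. card (unpaired F \<sigma>)"]
  obtain \<sigma> where "disjoint_pairing F \<sigma>"
    "\<forall>\<tau>. disjoint_pairing F \<tau> \<longrightarrow> card (unpaired F \<sigma>) \<le> card (unpaired F \<tau>)"
    by (elim exE conjE)
  then show ?thesis
    by (intro that) blast+
qed

text \<open>Otherwise \<open>x\<close> and \<open>y\<close> could be paired with each other, leaving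
  fewer faces unpaired.\<close>

lemma max_pairing_unpaired_intersect:
  assumes F: "finite F" and \<sigma>: "disjoint_pairing F \<sigma>"
    and max: "\<And>\<tau>. disjoint_pairing F \<tau> \<Longrightarrow> card (unpaired F \<sigma>) \<le> card (unpaired F \<tau>)"
    and x: "x \<in> unpaired F \<sigma>" "y \<in> unpaired F \<sigma>" "x \<noteq> y"
  shows "x \<inter> y \<noteq> {}"
proof
  assume disj: "x \<inter> y = {}"
  let ?t = "\<sigma>(x := y, y := x)"
  have "disjoint_pairing F ?t"
    unfolding disjoint_pairing_def
  proof
    fix f assume f: "f \<in> F"
    have "\<sigma> f \<in> F \<and> \<sigma> (\<sigma> f) = f \<and> (\<sigma> f \<noteq> f \<longrightarrow> \<sigma> f \<inter> f = {})"
      using f \<sigma> by (auto simp: disjoint_pairing_def)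
    moreover have "\<sigma> x = x" "\<sigma> y = y" using x by auto
    ultimately show "?t f \<in> F \<and> ?t (?t f) = f \<and> (?t f \<noteq> f \<longrightarrow> ?t f \<inter> f = {})"
      using x disj by (cases "f = x"; cases "f = y"; cases "\<sigma> f = x"; cases "\<sigma> f = y") auto
  qed
  moreover have "unpaired F ?t \<subset> unpaired F \<sigma>"
    using x by (auto split: if_splits)
  then have "card (unpaired F ?t) < card (unpaired F \<sigma>)"
    using F by (intro psubset_card_mono) auto
  ultimately show False using max by fastforce
qed

text \<open>An augmenting path of length three: if \<open>a\<close> misses \<open>x\<close> and the
  partner of \<open>a\<close> misses \<open>y\<close>, the pair can be broken up and its halves
  matched with \<open>x\<close> and \<open>y\<close>, leaving fewer faces unpaired.\<close>

lemma max_pairing_no_augmentation: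
  assumes F: "finite F" and \<sigma>: "disjoint_pairing F \<sigma>"
    and max: "\<And>\<tau>. disjoint_pairing F \<tau> \<Longrightarrow> card (unpaired F \<sigma>) \<le> card (unpaired F \<tau>)"
    and x: "x \<in> unpaired F \<sigma>" "y \<in> unpaired F \<sigma>" "x \<noteq> y"
    and a: "a \<in> F" "\<sigma> a \<noteq> a" and disj: "a \<inter> x = {}"
  shows "\<sigma> a \<inter> y \<noteq> {}"
proof
  assume disj': "\<sigma> a \<inter> y = {}"
  define b where "b = \<sigma> a"
  let ?t = "\<sigma>(a := x, x := a, b := y, y := b)"
  have ab: "b \<in> F" "\<sigma> b = a" "b \<noteq> a" "\<sigma> a = b" "\<sigma> x = x" "\<sigma> y = y" "b \<inter> y = {}"
    using a \<sigma> x disj' by (auto simp: disjoint_pairing_def b_def)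
  then have ne: "a \<noteq> x" "a \<noteq> y" "b \<noteq> x" "b \<noteq> y" by auto
  have t: "?t a = x" "?t x = a" "?t b = y" "?t y = b"
    using ne ab(3) x(3) by auto
  have "x \<inter> a = {}" "y \<inter> b = {}" using disj ab(7) by auto
  note facts = this disj ab(7) ab(1) a(1) x(1,2)
  have "disjoint_pairing F ?t"
    unfolding disjoint_pairing_def
  proof
    fix f assume f: "f \<in> F"
    have s: "\<sigma> f \<in> F" "\<sigma> (\<sigma> f) = f" "\<sigma> f \<noteq> f \<longrightarrow> \<sigma> f \<inter> f = {}"
      using f \<sigma> by (auto simp: disjoint_pairing_def)
    show "?t f \<in> F \<and> ?t (?t f) = f \<and> (?t f \<noteq> f \<longrightarrow> ?t f \<inter> f = {})"
    proof (cases "f \<in> {a, b, x, y}")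
      case True
      then consider "f = a" | "f = b" | "f = x" | "f = y" by blast
      then show ?thesis
        by cases (use facts in \<open>simp_all only: t mem_Collect_eq simp_thms\<close>)
    next
      case False
      have "\<sigma> f \<notin> {a, b, x, y}"
      proof
        assume "\<sigma> f \<in> {a, b, x, y}"
        then have "\<sigma> (\<sigma> f) \<in> {\<sigma> a, \<sigma> b, \<sigma> x, \<sigma> y}" by blast
        then show False using False by (simp only: s(2) ab insert_commute)
      qed
      with False have "?t f = \<sigma> f" "?t (\<sigma> f) = \<sigma> (\<sigma> f)" by simp_all
      then show ?thesis using s by (simp only: simp_thms)
    qed
  qed
  moreover have "unpaired F ?t \<subset> unpaired F \<sigma>"
    using x ab ne by (auto split: if_splits)
  then have "card (unpaired F ?t) < card (unpaired F \<sigma>)"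
    using F by (intro psubset_card_mono) auto
  ultimately show False using max by fastforce
qed

lemma card_unpaired_le:
  assumes T: "finite_abs_complex T" "two_faced T" and \<sigma>: "disjoint_pairing (faces T) \<sigma>"
    and max: "\<And>\<tau>. disjoint_pairing (faces T) \<tau> \<Longrightarrow>
      card (unpaired (faces T) \<sigma>) \<le> card (unpaired (faces T) \<tau>)"
    and large: "18 < card (unpaired (faces T) \<sigma>)"
  shows "int (card (unpaired (faces T) \<sigma>)) \<le> 2 * complex_euler_char T - 2"
proof -
  let ?F = "faces T" and ?X = "unpaired (faces T) \<sigma>"
  let ?P = "{f \<in> ?F. \<sigma> f \<noteq> f}"
  have F: "finite ?F" by (rule finite_simplices[OF T(1)])
  have s: "\<sigma> f \<in> ?F" "\<sigma> (\<sigma> f) = f" if "f \<in> ?F" for f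
    using \<sigma> that by (auto simp: disjoint_pairing_def)
  have ne: "f \<noteq> {}" if "f \<in> ?F" for f using faceD(1)[OF that] by auto
  have "\<exists>v. \<forall>f\<in>?X. v \<in> f"
  proof (rule pairwise_intersecting_faces_common_vertex[OF T])
    fix f g assume "f \<in> ?X" "g \<in> ?X"
    then show "f \<inter> g \<noteq> {}"
      using max_pairing_unpaired_intersect[OF F \<sigma> max, of f g] ne[of f] by (cases "f = g") auto
  qed (use large in auto)
  then obtain v where v: "\<And>f. f \<in> ?X \<Longrightarrow> v \<in> f" by blast
  have few: "card {x \<in> ?X. a \<inter> x \<noteq> {}} \<le> 6" if "a \<in> ?F" "v \<notin> a" for a
  proof -
    have "card {x \<in> ?X. a \<inter> x \<noteq> {}} \<le> card {f \<in> ?F. v \<in> f \<and> f \<inter> a \<noteq> {}}"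
      using v F by (intro card_mono) auto
    also have "\<dots> \<le> 6"
      using that faceD by (intro card_faces_meeting[OF T]) auto
    finally show ?thesis .
  qed
  \<comment> \<open>If \<open>v\<close> missed both faces of a pair, each of them would meet at most
    6 of the more than 18 unpaired faces. This leaves an \<open>x\<close> disjoint from
    \<open>a\<close> and a different \<open>y\<close> disjoint from its partner, an
    augmentation.\<close>
  have cover: "v \<in> a \<or> v \<in> \<sigma> a" if a: "a \<in> ?P" for a
  proof (rule ccontr)
    assume *: "\<not> (v \<in> a \<or> v \<in> \<sigma> a)"
    let ?A = "{x \<in> ?X. a \<inter> x \<noteq> {}}" and ?B = "{x \<in> ?X. \<sigma> a \<inter> x \<noteq> {}}"
    have "card (?X - ?A) > 0"
    proof -
      have "card ?X - card ?A \<le> card (?X - ?A)"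
        using F by (intro diff_card_le_card_Diff) auto
      then show ?thesis using few[of a] a * large by auto
    qed
    then obtain x where x: "x \<in> ?X - ?A" unfolding card_gt_0_iff by blast
    have "card (insert x ?B) \<le> 7"
      using few[of "\<sigma> a"] a s * F by (simp add: card_insert_if)
    moreover have "insert x ?B \<subseteq> ?X" using x by auto
    ultimately have "card (?X - insert x ?B) > 0"
      using large card_Diff_subset[OF finite_subset[OF \<open>insert x ?B \<subseteq> ?X\<close>], of ?X] F by simp
    then obtain y where y: "y \<in> ?X - insert x ?B" unfolding card_gt_0_iff by blast
    show False
      using max_pairing_no_augmentation[OF F \<sigma> max, of x y a] x y a by auto
  qed
  let ?A = "{f \<in> ?P. v \<in> f}"
  \<comment> \<open>Every pair has a face through \<open>v\<close>, so the paired faces through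
    \<open>v\<close> and their partners exhaust \<open>?P\<close>.\<close>
  have "?P \<subseteq> ?A \<union> \<sigma> ` ?A"
  proof
    fix f assume f: "f \<in> ?P"
    then have "\<sigma> f \<in> ?P" "f = \<sigma> (\<sigma> f)" using s[of f] by auto
    then show "f \<in> ?A \<union> \<sigma> ` ?A" using cover[OF f] f by blast
  qed
  then have "card ?P \<le> card (?A \<union> \<sigma> ` ?A)"
    using F by (intro card_mono) auto
  also have "\<dots> \<le> card ?A + card (\<sigma> ` ?A)" by (rule card_Un_le)
  also have "card (\<sigma> ` ?A) \<le> card ?A" using F by (intro card_image_le) auto
  finally have P: "card ?P \<le> 2 * card ?A" by simp
  have "card ?X + card ?A = card (?X \<union> ?A)"
    using F by (subst card_Un_disjoint) auto
  also have "\<dots> \<le> card {f \<in> ?F. v \<in> f}"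
    using F v by (intro card_mono) auto
  finally have deg: "card ?X + card ?A \<le> card {f \<in> ?F. v \<in> f}" .
  have "?X \<noteq> {}" using large by (metis card.empty not_less_zero)
  then have V: "v \<in> verts T"
    using v faceD(2) simplex_subset_verts[OF T(1)] by blast
  \<comment> \<open>Excludes truncation in the natural number
    \<open>card (verts T) - 1\<close>.\<close>
  then have "card (verts T) > 0"
    using T(1) by (auto simp: finite_abs_complex_def card_gt_0_iff)
  then have "int (card ?X) + int (card ?A) \<le> int (card (verts T)) - 1"
    using deg card_faces_at_vertex[OF T V] by linarith
  moreover have "card ?F = card ?X + card ?P"
    using F by (subst card_Un_disjoint[symmetric]) (auto intro: arg_cong[where f=card])
  then have "int (card ?F) = int (card ?X) + int (card ?P)" by simp
  moreover have "int (card ?P) \<le> 2 * int (card ?A)" using P by linarith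
  moreover note card_faces_eq[OF T]
  \<comment> \<open>With X, A, P for the cardinalities of \<open>?X\<close>, \<open>?A\<close>,
    \<open>?P\<close>: |F| = X + P <= X + 2 A <= 2 (|V| - 1) - X, whereas |F| = 2 (|V| -
    chi).\<close>
  ultimately show ?thesis
    by (simp add: algebra_simps)
qed

lemma cyclic_chromatic_number_le:
  assumes T: "finite_abs_complex T" "two_faced T"
  shows "int (cyclic_chromatic_number T) \<le> int (card (verts T)) + 9 + \<bar>complex_euler_char T\<bar>"
proof -
  obtain \<sigma> where \<sigma>: "disjoint_pairing (faces T) \<sigma>"
    and max: "\<And>\<tau>. disjoint_pairing (faces T) \<tau> \<Longrightarrow>
      card (unpaired (faces T) \<sigma>) \<le> card (unpaired (faces T) \<tau>)"
    using ex_max_pairing[OF finite_simplices(2)[OF T(1)]] by blast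
  have "18 < card (unpaired (faces T) \<sigma>) \<Longrightarrow>
      int (card (unpaired (faces T) \<sigma>)) \<le> 2 * complex_euler_char T - 2"
    using max by (intro card_unpaired_le[OF T \<sigma>]) blast+
  \<comment> \<open>A common bound for both cases. Its last term cancels against |F| = 2 (|V| -
    chi), and halving leaves 9 + |chi| above |V|.\<close>
  then have "int (card (unpaired (faces T) \<sigma>)) \<le> 18 + 2 * \<bar>complex_euler_char T\<bar> + 2 * complex_euler_char T"
    by (cases "18 < card (unpaired (faces T) \<sigma>)") auto
  moreover have "2 * int (cyclic_chromatic_number T) \<le>
      int (card (faces T)) + int (card (unpaired (faces T) \<sigma>))"
    using cyclic_chromatic_number_le_pairing[OF T(1) \<sigma>] by linarith
  moreover note card_faces_eq[OF T]
  ultimately show ?thesis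
    by (simp add: algebra_simps)
qed

section \<open>Geometric realization\<close>

text \<open>The carrier of \<open>geom_realization\<close> as a plain set, so that the type-class
  topology on functions applies to it.\<close>

definition realization :: "'v abs_complex \<Rightarrow> ('v \<Rightarrow> real) set" where
  "realization T = {x. (\<forall>v. 0 \<le> x v) \<and> {v. x v \<noteq> 0} \<in> simplices T \<and> (\<Sum>v\<in>verts T. x v) = 1}"

lemma geom_realization_eq: "geom_realization T = top_of_set (realization T)"
  by (simp add: geom_realization_def realization_def euclidean_product_topology)

abbreviation support :: "('v \<Rightarrow> real) \<Rightarrow> 'v set" where
  "support x \<equiv> {v. x v \<noteq> 0}"

lemma realizationD:
  assumes "finite_abs_complex T" "x \<in> realization T"
  shows "0 \<le> x v" "support x \<in> simplices T" "support x \<subseteq> verts T" "finite (support x)"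
    "sum x (verts T) = 1" "support x \<noteq> {}"
proof -
  show *: "0 \<le> x v" "support x \<in> simplices T" "sum x (verts T) = 1"
    using assms by (auto simp: realization_def)
  then show "support x \<subseteq> verts T" "finite (support x)"
    using simplex_subset_verts[OF assms(1)] by blast+
  show "support x \<noteq> {}"
  proof
    assume "support x = {}"
    then have "sum x (verts T) = 0" by auto
    then show False using * by simp
  qed
qed

lemma sum_supported:
  assumes T: "finite_abs_complex T" and "x \<in> realization T" "support x \<subseteq> s" "finite s"
  shows "sum x s = 1"
proof -
  have fin: "finite (verts T)" using T by (simp add: finite_abs_complex_def)
  have "sum x s = sum x (support x)"
    using assms by (intro sum.mono_neutral_right) auto
  also have "\<dots> = sum x (verts T)"
    using realizationD[OF assms(1,2)] fin by (intro sum.mono_neutral_left) auto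
  finally show ?thesis using realizationD(5)[OF assms(1,2)] by simp
qed

lemma realizationI:
  assumes T: "finite_abs_complex T" and s: "s \<in> simplices T" and x: "\<And>v. 0 \<le> x v" "support x \<subseteq> s" "sum x s = 1"
  shows "x \<in> realization T"
proof -
  have "support x \<in> simplices T" using simplex_mono[OF T s x(2)] .
  moreover have "sum x (verts T) = sum x s"
    using simplex_subset_verts[OF T s] x(2) T
    by (intro sum.mono_neutral_right) (auto simp: finite_abs_complex_def)
  ultimately show ?thesis using x by (simp add: realization_def)
qed

definition barycenter :: "'v set \<Rightarrow> 'v \<Rightarrow> real" where
  "barycenter s = (\<lambda>v. if v \<in> s then 1 / real (card s) else 0)"

lemma barycenter_in_realization:
  assumes T: "finite_abs_complex T" and s: "s \<in> simplices T" "s \<noteq> {}"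
  shows "barycenter s \<in> realization T" "support (barycenter s) = s"
proof -
  have fin: "finite s" using simplex_subset_verts[OF T s(1)] by simp
  then show "support (barycenter s) = s"
    using s by (auto simp: barycenter_def)
  with fin s show "barycenter s \<in> realization T"
    by (intro realizationI[OF T s(1)]) (auto simp: barycenter_def)
qed

lemma convex_combination_in_realization:
  assumes T: "finite_abs_complex T" and x: "x \<in> realization T" "y \<in> realization T"
    and s: "support x \<subseteq> s" "support y \<subseteq> s" "s \<in> simplices T" and t: "0 \<le> t" "t \<le> 1"
  shows "(\<lambda>v. (1 - t) * x v + t * y v) \<in> realization T"
proof (rule realizationI[OF T s(3)])
  have fin: "finite s" using simplex_subset_verts[OF T s(3)] by simp
  show "0 \<le> (1 - t) * x v + t * y v" for v
    using t realizationD(1)[OF T x(1)] realizationD(1)[OF T x(2)] by simp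
  show "support (\<lambda>v. (1 - t) * x v + t * y v) \<subseteq> s"
  proof clarify
    fix v assume "(1 - t) * x v + t * y v \<noteq> 0"
    then have "x v \<noteq> 0 \<or> y v \<noteq> 0" by auto
    then show "v \<in> s" using s by blast
  qed
  have "(\<Sum>v\<in>s. (1 - t) * x v + t * y v) = (1 - t) * sum x s + t * sum y s"
    by (simp add: sum.distrib sum_distrib_left)
  then show "(\<Sum>v\<in>s. (1 - t) * x v + t * y v) = 1"
    using sum_supported[OF T x(1) s(1) fin] sum_supported[OF T x(2) s(2) fin] by simp
qed

text \<open>Moving \<open>p\<close> slightly towards the barycenter of \<open>s\<close> stays in
  \<open>N\<close> and makes every coordinate in \<open>s\<close> positive. Hence a neighbourhood of
  \<open>p\<close> whose supports are known reveals all simplices containing the support of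
  \<open>p\<close>.\<close>

lemma open_meets_star:
  assumes T: "finite_abs_complex T" and N: "openin (top_of_set (realization T)) N" "p \<in> N"
    and s: "s \<in> simplices T" "support p \<subseteq> s"
  shows "\<exists>x\<in>N. support x = s"
proof -
  obtain W where W: "open W" "N = realization T \<inter> W"
    using N(1) by (auto simp: openin_open)
  then have p: "p \<in> realization T" using N by simp
  then have "s \<noteq> {}" using realizationD(6)[OF T p] s by auto
  note b = barycenter_in_realization[OF T s(1) this]
  let ?q = "\<lambda>t v. (1 - t) * p v + t * barycenter s v"
  have "continuous_on UNIV ?q"
    by (intro continuous_on_coordinatewise_then_product continuous_intros)
  then have "open (?q -` W)"
    using W(1) by (simp add: continuous_on_open_vimage open_vimage)
  moreover have "0 \<in> ?q -` W" using N W by simp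
  ultimately obtain e where e: "e > 0" "ball 0 e \<subseteq> ?q -` W"
    by (meson openE)
  define t where "t = min (e / 2) (1 / 2)"
  have t: "0 < t" "t < 1" "t \<in> ball 0 e" using e by (auto simp: t_def)
  then have "?q t \<in> W" using e by blast
  moreover have "?q t \<in> realization T"
    using convex_combination_in_realization[OF T p b(1) s(2)] b s t by simp
  moreover have "support (?q t) = s"
  proof -
    have "?q t v = 0 \<longleftrightarrow> v \<notin> s" for v
    proof (cases "v \<in> s")
      case True
      then have "0 < barycenter s v"
        using simplex_subset_verts(2)[OF T s(1)] by (auto simp: barycenter_def card_gt_0_iff)
      then have "0 < ?q t v"
        using t realizationD(1)[OF T p, of v] by (intro add_nonneg_pos) auto
      then show ?thesis using True by simp
    next
      case False
      then show ?thesis using s(2) by (auto simp: barycenter_def)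
    qed
    then show ?thesis by auto
  qed
  ultimately show ?thesis
    unfolding W(2) by (intro bexI[of _ "?q t"] IntI)
qed

text \<open>The charts of \<open>two_manifold\<close>, stated for a set in a type-class topology so
  that invariance of domain can be applied to them.\<close>

definition locally_planar :: "'b::topological_space set \<Rightarrow> bool" where
  "locally_planar X \<longleftrightarrow> (\<forall>p\<in>X. \<exists>U \<theta> \<theta>'. openin (top_of_set X) U \<and> p \<in> U \<and>
     homeomorphism U (UNIV :: (real^2) set) \<theta> \<theta>')"

lemma locally_planar_if_two_manifold:
  fixes X :: "'b::topological_space set"
  assumes "top_of_set X homeomorphic_space M" "two_manifold M"
  shows "locally_planar X"
  unfolding locally_planar_def
proof
  fix p assume p: "p \<in> X"
  obtain h k where hk: "homeomorphic_maps (top_of_set X) M h k"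
    using assms(1) by (auto simp: homeomorphic_space_def)
  then have h: "continuous_map (top_of_set X) M h" and k: "continuous_map M (top_of_set X) k"
    and kh: "\<And>x. x \<in> X \<Longrightarrow> k (h x) = x" and hk': "\<And>y. y \<in> topspace M \<Longrightarrow> h (k y) = y"
    by (auto simp: homeomorphic_maps_def)
  have "h p \<in> topspace M" using h p by (auto simp: continuous_map_def)
  then obtain U where U: "openin M U" "h p \<in> U"
    and "subtopology M U homeomorphic_space (euclidean :: (real^2) topology)"
    using assms(2) unfolding two_manifold_def by blast
  then obtain a b where "homeomorphic_maps (subtopology M U) (euclidean :: (real^2) topology) a b"
    by (auto simp: homeomorphic_space_def)
  moreover have UM: "U \<subseteq> topspace M" using U(1) openin_subset by blast
  ultimately have a: "continuous_map (subtopology M U) euclidean a"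
    and b: "continuous_map euclidean (subtopology M U) b"
    and ba: "\<And>y. y \<in> U \<Longrightarrow> b (a y) = y" and ab: "\<And>z. a (b z) = z"
    by (auto simp: homeomorphic_maps_def)
  let ?O = "{x \<in> X. h x \<in> U}"
  have "openin (top_of_set X) ?O"
    using openin_continuous_map_preimage[OF h U(1)] by simp
  moreover have "homeomorphism ?O UNIV (a \<circ> h) (k \<circ> b)"
  proof -
    have bU: "b z \<in> U" for z using b by (auto simp: continuous_map_def)
    have "continuous_map (top_of_set ?O) (subtopology M U) h"
    proof (rule continuous_map_into_subtopology)
      show "continuous_map (top_of_set ?O) M h"
        using continuous_map_from_subtopology[OF h, of ?O]
        by (simp add: subtopology_subtopology Int_absorb1 Collect_conj_eq)
    qed auto
    then have "continuous_map (top_of_set ?O) euclidean (a \<circ> h)"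
      using a continuous_map_compose by blast
    moreover have "continuous_map euclidean (top_of_set X) (k \<circ> b)"
      using continuous_map_compose[OF _ k] b continuous_map_in_subtopology by blast
    ultimately have "continuous_on ?O (a \<circ> h)" "continuous_on UNIV (k \<circ> b)"
      by (simp_all add: continuous_map_in_subtopology)
    moreover have kX: "k y \<in> X" if "y \<in> topspace M" for y
      using k that by (auto simp: continuous_map_def)
    have bM: "b z \<in> topspace M" for z using bU UM by blast
    have "(k \<circ> b) z \<in> ?O" for z
      using bU[of z] by (simp add: kX[OF bM] hk'[OF bM])
    then have "(k \<circ> b) ` UNIV \<subseteq> ?O" by blast
    moreover have "(a \<circ> h) ((k \<circ> b) z) = z" for z
      by (simp add: hk'[OF bM] ab)
    ultimately show ?thesis
      by (intro homeomorphismI) (simp_all add: kh ba del: comp_apply, simp_all add: kh ba)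
  qed
  ultimately show "\<exists>U \<theta> \<theta>'. openin (top_of_set X) U \<and> p \<in> U \<and>
     homeomorphism U (UNIV :: (real^2) set) \<theta> \<theta>'"
    using p U(2) by (intro exI[of _ ?O] exI[of _ "a \<circ> h"] exI[of _ "k \<circ> b"]) simp
qed

lemma locally_planar_open_infinite:
  assumes "locally_planar X" "openin (top_of_set X) U" "p \<in> U"
  shows "infinite U"
proof
  assume fin: "finite U"
  have "p \<in> X" using assms(2,3) openin_subset by fastforce
  then obtain N \<theta> \<theta>' where N: "openin (top_of_set X) N" "p \<in> N"
    and hom: "homeomorphism N (UNIV :: (real^2) set) \<theta> \<theta>'"
    using assms(1) unfolding locally_planar_def by blast
  have "openin (top_of_set N) (N \<inter> U)"
    using assms(2) N(1) by (metis Int_commute openin_Int openin_imp_subset openin_subset_trans inf_le1)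
  then have "openin (top_of_set UNIV) (\<theta> ` (N \<inter> U))"
    using homeomorphism_imp_open_map[OF hom] by blast
  then have "open (\<theta> ` (N \<inter> U))" by simp
  moreover have "\<theta> p \<in> \<theta> ` (N \<inter> U)" using N assms(3) by blast
  moreover have "finite (\<theta> ` (N \<inter> U))" using fin by simp
  ultimately show False
    using not_open_singleton finite_imp_not_open by blast
qed

text \<open>Inside a chart the plane minus a finite set is connected, so lying in one component of
  \<open>X - S\<close> is an equivalence relation that is locally trivial off \<open>S\<close>.
  Connectedness of \<open>X\<close> makes it globally trivial, since every nonempty open set has
  points outside \<open>S\<close>.\<close>

lemma connected_diff_finite:
  fixes X :: "'b::topological_space set"
  assumes X: "connected X" "locally_planar X" and S: "finite S"
  shows "connected (X - S)"
proof -
  have "connected_component (X - S) a b" if ab: "a \<in> X - S" "b \<in> X - S" for a b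
  proof (rule connected_equivalence_relation_gen[OF X(1), where P = "\<lambda>x. x \<notin> S"])
    show "\<exists>z. z \<in> U \<and> z \<notin> S" if "openin (top_of_set X) U" "x \<in> U" for U x
      using locally_planar_open_infinite[OF X(2) that] S by (meson infinite_super subsetI)
    fix p assume "p \<in> X"
    then obtain N \<theta> \<theta>' where N: "openin (top_of_set X) N" "p \<in> N"
      and hom: "homeomorphism N (UNIV :: (real^2) set) \<theta> \<theta>'"
      using X(2) unfolding locally_planar_def by blast
    have "connected (UNIV - \<theta> ` (N \<inter> S))"
      by (rule connected_open_diff_countable) (use S in \<open>auto intro: countable_finite\<close>)
    then have "connected (\<theta>' ` (UNIV - \<theta> ` (N \<inter> S)))"
      using hom by (metis connected_continuous_image continuous_on_subset homeomorphism_cont2 subset_UNIV)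
    moreover have "\<theta>' ` (UNIV - \<theta> ` (N \<inter> S)) = N - S"
    proof -
      have *: "\<theta>' (\<theta> x) = x" if "x \<in> N" for x using hom that by (simp add: homeomorphism_def)
      have **: "\<theta> (\<theta>' z) = z" "\<theta>' z \<in> N" for z using hom by (auto simp: homeomorphism_def)
      show ?thesis
      proof (intro equalityI subsetI)
        fix x assume x: "x \<in> N - S"
        then have "\<theta> x \<notin> \<theta> ` (N \<inter> S)" using * by (metis DiffE IntE imageE)
        then show "x \<in> \<theta>' ` (UNIV - \<theta> ` (N \<inter> S))" using x *[of x] by (metis DiffE DiffI UNIV_I image_eqI)
      next
        fix x assume "x \<in> \<theta>' ` (UNIV - \<theta> ` (N \<inter> S))"
        then obtain z where "x = \<theta>' z" "z \<notin> \<theta> ` (N \<inter> S)" by blast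
        then show "x \<in> N - S" using **[of z] by (metis DiffI IntI image_eqI)
      qed
    qed
    ultimately have "connected (N - S)" by simp
    moreover have "N - S \<subseteq> X - S" using openin_imp_subset[OF N(1)] by blast
    ultimately have "\<forall>x\<in>N. \<forall>y\<in>N. x \<notin> S \<and> y \<notin> S \<longrightarrow> connected_component (X - S) x y"
      unfolding connected_component_def by blast
    then show "\<exists>U. openin (top_of_set X) U \<and> p \<in> U \<and>
        (\<forall>x\<in>U. \<forall>y\<in>U. x \<notin> S \<and> y \<notin> S \<longrightarrow> connected_component (X - S) x y)"
      using N by blast
  qed (use ab connected_component_trans in blast)+
  then show ?thesis
    by (simp add: connected_iff_connected_component)
qed

section \<open>Local structure at an edge\<close>

text \<open>The two faces already fill a neighbourhood of the midpoint of the edge. A further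
  simplex containing the edge would have points with full support in it, by
  \<open>open_meets_star\<close>, but only three supports occur there.\<close>

lemma simplices_at_edge_in_two_faces:
  assumes T: "finite_abs_complex T" and plane: "locally_planar (realization T)"
    and f: "{a, b, c} \<in> faces T" and g: "{a, b, d} \<in> faces T" and "c \<noteq> d"
    and s: "s \<in> simplices T" "{a, b} \<subseteq> s"
  shows "s \<in> {{a, b}, {a, b, c}, {a, b, d}}"
proof -
  have ne: "a \<noteq> b" "a \<noteq> c" "b \<noteq> c" "a \<noteq> d" "b \<noteq> d"
    using faceD(1)[OF f] faceD(1)[OF g] by (auto simp: card_insert_if split: if_splits)
  \<comment> \<open>\<open>\<mu>\<close> maps a planar open set onto two half-discs of the two faces glued along the edge, so its image
    is open in the realization by invariance of domain.\<close>
  define \<mu> :: "real \<times> real \<Rightarrow> 'a \<Rightarrow> real" where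
    "\<mu> = (\<lambda>z v. if v = a then (1 - \<bar>snd z\<bar>) / 2 + fst z else if v = b then (1 - \<bar>snd z\<bar>) / 2 - fst z
       else if v = c then max (snd z) 0 else if v = d then max (- snd z) 0 else 0)"
  \<comment> \<open>Exactly the region where the coordinates of \<open>\<mu> z\<close> at
    \<open>a\<close> and \<open>b\<close> are positive. The sign of \<open>snd z\<close> selects the
    face.\<close>
  define D :: "(real \<times> real) set" where "D = {z. 2 * \<bar>fst z\<bar> < 1 - \<bar>snd z\<bar>}"
  have "open D" unfolding D_def
    by (intro open_Collect_less continuous_intros)
  have cont: "continuous_on S \<mu>" for S
    unfolding \<mu>_def
  proof (rule continuous_on_coordinatewise_then_product)
    fix v
    show "continuous_on S (\<lambda>z. if v = a then (1 - \<bar>snd z\<bar>) / 2 + fst z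
       else if v = b then (1 - \<bar>snd z\<bar>) / 2 - fst z
       else if v = c then max (snd z) 0 else if v = d then max (- snd z) 0 else 0)"
      by (cases "v = a"; cases "v = b"; cases "v = c"; cases "v = d")
        (auto intro!: continuous_intros)
  qed
  have \<mu>_simps: "\<mu> z a = (1 - \<bar>snd z\<bar>) / 2 + fst z" "\<mu> z b = (1 - \<bar>snd z\<bar>) / 2 - fst z"
    "\<mu> z c = max (snd z) 0" "\<mu> z d = max (- snd z) 0" for z
    using ne \<open>c \<noteq> d\<close> by (simp_all add: \<mu>_def)
  have \<mu>_0: "\<mu> z v = 0" if "v \<noteq> a" "v \<noteq> b" "v \<noteq> c" "v \<noteq> d" for z v
    using that by (simp add: \<mu>_def)
  have inj: "inj \<mu>"
  proof (rule injI)
    fix z w assume eq: "\<mu> z = \<mu> w"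
    have "\<mu> z c - \<mu> z d = snd z" "(\<mu> z a - \<mu> z b) / 2 = fst z" for z
      by (simp_all add: \<mu>_simps max_def field_simps)
    then show "z = w" by (metis eq prod_eq_iff)
  qed
  have supp: "support (\<mu> z) = (if snd z = 0 then {a, b} else if snd z > 0 then {a, b, c} else {a, b, d})"
    if z: "z \<in> D" for z
  proof -
    have pos: "0 < \<mu> z a" "0 < \<mu> z b"
      using z unfolding \<mu>_simps D_def mem_Collect_eq by (auto simp: field_simps abs_real_def split: if_splits)
    have "\<mu> z v \<noteq> 0 \<longleftrightarrow> v = a \<or> v = b \<or> v = c \<and> 0 < snd z \<or> v = d \<and> snd z < 0" for v
    proof -
      consider "v = a" | "v = b" | "v = c" | "v = d" | "v \<noteq> a" "v \<noteq> b" "v \<noteq> c" "v \<noteq> d"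
        by blast
      then show ?thesis
      proof cases
        case 3
        have "\<mu> z c \<noteq> 0 \<longleftrightarrow> 0 < snd z" by (simp add: \<mu>_simps max_def)
        then show ?thesis using 3 ne \<open>c \<noteq> d\<close> by simp
      next
        case 4
        have "\<mu> z d \<noteq> 0 \<longleftrightarrow> snd z < 0" by (simp add: \<mu>_simps max_def)
        then show ?thesis using 4 ne \<open>c \<noteq> d\<close> by simp
      qed (use pos \<mu>_0 in simp_all)
    qed
    then show ?thesis by auto
  qed
  have nonneg: "0 \<le> \<mu> z v" if z: "z \<in> D" for z v
  proof -
    have pos: "0 < \<mu> z a" "0 < \<mu> z b"
      using z unfolding \<mu>_simps D_def mem_Collect_eq by (auto simp: field_simps abs_real_def split: if_splits)
    moreover have "0 \<le> \<mu> z c" "0 \<le> \<mu> z d" by (simp_all add: \<mu>_simps)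
    ultimately show ?thesis using \<mu>_0[of v z] by (metis less_imp_le order_refl)
  qed
  have X: "\<mu> z \<in> realization T" if z: "z \<in> D" for z
  proof (cases "snd z > 0")
    case True
    show ?thesis
    proof (rule realizationI[OF T faceD(2)[OF f]])
      show "0 \<le> \<mu> z v" for v by (rule nonneg[OF z])
      show "support (\<mu> z) \<subseteq> {a, b, c}" using True supp[OF z] by simp
      have "sum (\<mu> z) {a, b, c} = \<mu> z a + \<mu> z b + \<mu> z c" using ne by simp
      then show "sum (\<mu> z) {a, b, c} = 1" using True by (simp add: \<mu>_simps field_simps)
    qed
  next
    case False
    show ?thesis
    proof (rule realizationI[OF T faceD(2)[OF g]])
      show "0 \<le> \<mu> z v" for v by (rule nonneg[OF z])
      show "support (\<mu> z) \<subseteq> {a, b, d}" using False supp[OF z] by auto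
      have "sum (\<mu> z) {a, b, d} = \<mu> z a + \<mu> z b + \<mu> z d" using ne by simp
      then show "sum (\<mu> z) {a, b, d} = 1" using False by (simp add: \<mu>_simps field_simps)
    qed
  qed
  have 0: "(0, 0) \<in> D" by (simp add: D_def)
  obtain N \<theta> \<theta>' where N: "openin (top_of_set (realization T)) N" "\<mu> (0, 0) \<in> N"
    and hom: "homeomorphism N (UNIV :: (real^2) set) \<theta> \<theta>'"
    using plane X[OF 0] unfolding locally_planar_def by blast
  obtain W where W: "open W" "N = realization T \<inter> W"
    using N(1) by (auto simp: openin_open)
  define D' where "D' = D \<inter> \<mu> -` W"
  have "open D'" unfolding D'_def
    using continuous_open_preimage[OF cont \<open>open D\<close> W(1)] .
  have D'N: "\<mu> ` D' \<subseteq> N" using X by (auto simp: D'_def W)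
  have inj\<theta>: "inj_on \<theta> N"
    using hom by (auto simp: homeomorphism_def intro: inj_on_inverseI)
  have "open ((\<theta> \<circ> \<mu>) ` D')"
  proof (rule invariance_of_domain_gen[OF \<open>open D'\<close>])
    show "continuous_on D' (\<theta> \<circ> \<mu>)"
      using hom D'N cont by (meson continuous_on_compose continuous_on_subset homeomorphism_cont1)
    show "inj_on (\<theta> \<circ> \<mu>) D'"
      using inj inj_on_subset[OF inj\<theta> D'N] by (intro comp_inj_on) (auto intro: inj_on_subset)
  qed auto
  then have "openin (top_of_set N) (N \<inter> \<theta> -` ((\<theta> \<circ> \<mu>) ` D'))"
    using hom by (intro continuous_openin_preimage_gen) (auto simp: homeomorphism_def)
  moreover have "N \<inter> \<theta> -` ((\<theta> \<circ> \<mu>) ` D') = \<mu> ` D'"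
  proof (intro equalityI subsetI)
    fix x assume "x \<in> N \<inter> \<theta> -` ((\<theta> \<circ> \<mu>) ` D')"
    then obtain z where "x \<in> N" "z \<in> D'" "\<theta> x = \<theta> (\<mu> z)" by auto
    then show "x \<in> \<mu> ` D'" using inj_onD[OF inj\<theta>, of x "\<mu> z"] D'N by blast
  qed (use D'N in auto)
  ultimately have "openin (top_of_set (realization T)) (\<mu> ` D')"
    using N(1) openin_trans by metis
  moreover have "\<mu> (0, 0) \<in> \<mu> ` D'" using N 0 W by (auto simp: D'_def)
  moreover have "support (\<mu> (0, 0)) \<subseteq> s" using s(2) supp[OF 0] by simp
  ultimately have "\<exists>x\<in>\<mu> ` D'. support x = s"
    by (rule open_meets_star[OF T _ _ s(1)])
  then obtain z where "z \<in> D'" "support (\<mu> z) = s" by (elim bexE imageE) simp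
  then have "z \<in> D" "support (\<mu> z) = s" by (simp_all add: D'_def)
  then have "s = (if snd z = 0 then {a, b} else if snd z > 0 then {a, b, c} else {a, b, d})"
    using supp[of z] by (simp only:)
  then show ?thesis by (simp split: if_splits)
qed

lemma edge_in_two_faces:
  assumes T: "finite_abs_complex T" and plane: "locally_planar (realization T)"
    and e: "{a, b} \<in> edges T"
  shows "\<exists>c d. c \<noteq> d \<and> {a, b, c} \<in> faces T \<and> {a, b, d} \<in> faces T"
proof (rule ccontr)
  assume no: "\<not> ?thesis"
  have ab: "a \<noteq> b" using edgeD(1)[OF e] by auto
  \<comment> \<open>If the edge lies in no face at all, \<open>c\<close> may be \<open>a\<close> or
    \<open>b\<close>, so later steps cannot assume three distinct vertices.\<close>
  have "\<exists>c. \<forall>s\<in>simplices T. {a, b} \<subseteq> s \<longrightarrow> s \<subseteq> {a, b, c}"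
  proof (rule ccontr)
    assume no': "\<not> ?thesis"
    then obtain s c where s: "s \<in> simplices T" "{a, b} \<subseteq> s" "c \<in> s" "c \<notin> {a, b}" by blast
    obtain s' d where s': "s' \<in> simplices T" "{a, b} \<subseteq> s'" "d \<in> s'" "d \<notin> {a, b, c}"
      using no' by blast
    have "{a, b, c} \<in> faces T" "{a, b, d} \<in> faces T"
      using simplex_mono[OF T s(1)] simplex_mono[OF T s'(1)] s s' ab by (auto simp: faces_def)
    then show False using no s'(4) by blast
  qed
  then obtain c where c': "\<forall>s\<in>simplices T. {a, b} \<subseteq> s \<longrightarrow> s \<subseteq> {a, b, c}" ..
  have c: "s \<subseteq> {a, b, c}" if "s \<in> simplices T" "{a, b} \<subseteq> s" for s
    using c'[rule_format, OF that] .
  \<comment> \<open>If only one face contained the edge, \<open>\<nu>\<close> would embed the open star of the edge into a closed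
    half-plane, taking the midpoint \<open>p\<close> to its boundary.\<close>
  define star where "star = {x \<in> realization T. 0 < x a \<and> 0 < x b}"
  define \<nu> :: "('a \<Rightarrow> real) \<Rightarrow> real \<times> real" where "\<nu> x = (x a - x b, 1 - x a - x b)" for x
  have sub: "support x \<subseteq> {a, b, c}" if "x \<in> star" for x
    using that realizationD(2)[OF T, of x] by (intro c) (auto simp: star_def)
  have sum: "sum x {a, b, c} = 1" if "x \<in> star" for x
    using sum_supported[OF T _ sub[OF that]] that by (simp add: star_def)
  have inj: "inj_on \<nu> star"
  proof (rule inj_onI)
    fix x y assume xy: "x \<in> star" "y \<in> star" "\<nu> x = \<nu> y"
    then have *: "x a = y a" "x b = y b" by (auto simp: \<nu>_def)
    moreover have "x c = y c"
    proof (cases "c \<in> {a, b}")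
      case False
      then show ?thesis using sum[OF xy(1)] sum[OF xy(2)] * ab by auto
    qed (use * in auto)
    moreover have "x v = y v" if "v \<notin> {a, b, c}" for v
    proof -
      have "x v = 0" using that sub[OF xy(1)] by auto
      moreover have "y v = 0" using that sub[OF xy(2)] by auto
      ultimately show ?thesis by simp
    qed
    ultimately show "x = y" by (metis ext insertE singletonD)
  qed
  have nonneg: "0 \<le> snd (\<nu> x)" if "x \<in> star" for x
  proof -
    have "x a + x b = sum x {a, b}" using ab by simp
    also have "\<dots> \<le> sum x {a, b, c}"
      using that realizationD(1)[OF T] by (intro sum_mono2) (auto simp: star_def)
    finally show ?thesis using sum[OF that] by (simp add: \<nu>_def)
  qed
  have cont: "continuous_on S \<nu>" for S
    unfolding \<nu>_def
    by (intro continuous_intros continuous_on_product_then_coordinatewise continuous_on_id)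
  define p where "p = barycenter {a, b}"
  have p: "p \<in> realization T" "p a = 1 / 2" "p b = 1 / 2"
    using barycenter_in_realization[OF T edgeD(2)[OF e]] ab by (auto simp: p_def barycenter_def)
  then have pstar: "p \<in> star" and \<nu>p: "\<nu> p = (0, 0)"
    by (auto simp: star_def \<nu>_def)
  obtain N \<theta> \<theta>' where N: "openin (top_of_set (realization T)) N" "p \<in> N"
    and hom: "homeomorphism N (UNIV :: (real^2) set) \<theta> \<theta>'"
    using plane p(1) unfolding locally_planar_def by blast
  have "open {x :: 'a \<Rightarrow> real. 0 < x a \<and> 0 < x b}"
    by (intro open_Collect_conj open_Collect_less continuous_on_const continuous_on_product_coordinates)
  then have "openin (top_of_set (realization T)) star"
    unfolding openin_open star_def by blast
  then have "openin (top_of_set N) (N \<inter> star)"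
    using N(1) by (metis Int_commute openin_Int openin_imp_subset openin_subset_trans inf_le1)
  then have op: "open (\<theta> ` (N \<inter> star))"
    using homeomorphism_imp_open_map[OF hom] by fastforce
  have inv: "\<theta>' (\<theta> x) = x" if "x \<in> N" for x using hom that by (simp add: homeomorphism_def)
  have im: "\<theta>' ` \<theta> ` (N \<inter> star) = N \<inter> star"
    using inv by (force simp: image_iff)
  have "open ((\<nu> \<circ> \<theta>') ` \<theta> ` (N \<inter> star))"
  proof (rule invariance_of_domain_gen[OF op])
    show "continuous_on (\<theta> ` (N \<inter> star)) (\<nu> \<circ> \<theta>')"
      using hom cont by (meson continuous_on_compose continuous_on_subset homeomorphism_cont2 subset_UNIV)
    show "inj_on (\<nu> \<circ> \<theta>') (\<theta> ` (N \<inter> star))"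
      by (rule comp_inj_on) (use inv im inj in \<open>auto intro: inj_on_subset intro!: inj_on_inverseI[where g=\<theta>] simp: inj_on_def\<close>)
  qed auto
  then have "open (\<nu> ` (N \<inter> star))" by (simp only: image_comp[symmetric] im)
  moreover have "(0, 0) \<in> \<nu> ` (N \<inter> star)" using N(2) pstar \<nu>p by (metis IntI image_eqI)
  ultimately obtain e where e: "0 < e" "ball (0, 0) e \<subseteq> \<nu> ` (N \<inter> star)"
    by (meson openE)
  have "(0, - (e / 2)) \<in> ball (0, 0) e" using e by (simp add: dist_Pair_Pair)
  then have "(0, - (e / 2)) \<in> \<nu> ` (N \<inter> star)" using e(2) by blast
  then obtain x where x: "(0, - (e / 2)) = \<nu> x" "x \<in> N \<inter> star" by (rule imageE)
  then have "0 \<le> snd (\<nu> x)" by (intro nonneg) simp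
  then show False using e(1) unfolding x(1)[symmetric] by simp
qed

lemma two_faced_if_locally_planar:
  assumes T: "finite_abs_complex T" and plane: "locally_planar (realization T)"
  shows "two_faced T"
  unfolding two_faced_def
proof
  fix e assume e: "e \<in> edges T"
  then obtain a b where ab: "e = {a, b}" "a \<noteq> b" using edgeD(1) card_2_iff by metis
  obtain c d where cd: "c \<noteq> d" "{a, b, c} \<in> faces T" "{a, b, d} \<in> faces T"
    using edge_in_two_faces[OF T plane] e ab by blast
  have "f \<in> {{a, b, c}, {a, b, d}}" if f: "f \<in> faces T" "e \<subseteq> f" for f
    using simplices_at_edge_in_two_faces[OF T plane cd(2,3,1) faceD(2)[OF f(1)]] f faceD(1)[OF f(1)] ab
    by auto
  then have "{f \<in> faces T. e \<subseteq> f} = {{a, b, c}, {a, b, d}}"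
    using cd ab by auto
  moreover have "{a, b, c} \<noteq> {a, b, d}"
    using cd faceD(1)[OF cd(2)] faceD(1)[OF cd(3)] by (auto simp: card_insert_if split: if_splits)
  ultimately show "card {f \<in> faces T. e \<subseteq> f} = 2" by simp
qed

text \<open>A simplex on \<open>a\<close>, \<open>b\<close>, \<open>c\<close>, \<open>d\<close>
  would contain the edge \<open>{a, b}\<close> without being one of the three simplices that the
  faces \<open>{a, b, c}\<close> and \<open>{a, b, d}\<close> allow around it.\<close>

lemma card_simplex_le_3:
  assumes T: "finite_abs_complex T" and plane: "locally_planar (realization T)"
    and s: "s \<in> simplices T"
  shows "card s \<le> 3"
proof (rule ccontr)
  assume "\<not> ?thesis"
  then obtain t where t: "t \<subseteq> s" "card t = 4"
    using obtain_subset_with_card_n[of 4 s] by force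
  then have "card t = Suc (Suc (Suc (Suc 0)))" by simp
  then obtain a b c d where abcd: "t = {a, b, c, d}" "distinct [a, b, c, d]"
    by (auto simp: card_Suc_eq)
  have "{a, b, c} \<in> faces T" "{a, b, d} \<in> faces T"
    using simplex_mono[OF T s] t(1) abcd by (auto simp: faces_def)
  moreover have "t \<in> simplices T" using simplex_mono[OF T s t(1)] .
  ultimately have "t \<in> {{a, b}, {a, b, c}, {a, b, d}}"
    using abcd by (intro simplices_at_edge_in_two_faces[OF T plane]) auto
  then show False using abcd by auto
qed


section \<open>Connectedness of the 1-skeleton and of the dual graph\<close>

lemma closedin_subcomplex: "closedin (top_of_set Y) {x \<in> Y. support x \<subseteq> s}"
proof -
  have "closed (\<Inter>v\<in>- s. {x :: 'a \<Rightarrow> real. x v = 0})"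
    by (intro closed_INT ballI closed_Collect_eq continuous_on_const continuous_on_product_coordinates)
  moreover have "{x \<in> Y. support x \<subseteq> s} = Y \<inter> (\<Inter>v\<in>- s. {x. x v = 0})"
    by auto
  ultimately show ?thesis by (auto simp: closedin_closed)
qed

text \<open>Any two vertices of a support span an edge, so a support lies inside \<open>A\<close> or
  avoids it. The realization thus splits into two disjoint closed sets.\<close>

lemma one_skeleton_connected:
  assumes T: "finite_abs_complex T" and conn: "connected (realization T)"
    and A: "A \<subseteq> verts T" "A \<noteq> {}"
    and closed: "\<And>a b. a \<in> A \<Longrightarrow> {a, b} \<in> edges T \<Longrightarrow> b \<in> A"
  shows "A = verts T"
proof (rule ccontr)
  assume ne: "A \<noteq> verts T"
  let ?X = "realization T"
  let ?E = "{x \<in> ?X. support x \<subseteq> A}" and ?F = "{x \<in> ?X. support x \<subseteq> verts T - A}"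
  have vert: "barycenter {v} \<in> ?X" "support (barycenter {v}) = {v}" if "v \<in> verts T" for v
    using that T barycenter_in_realization[OF T, of "{v}"] by (auto simp: finite_abs_complex_def)
  have "?X \<subseteq> ?E \<union> ?F"
  proof
    fix x assume x: "x \<in> ?X"
    note D = realizationD[OF T x]
    have "b \<in> A" if ab: "a \<in> support x" "b \<in> support x" "a \<in> A" for a b
    proof (cases "a = b")
      case False
      then have "{a, b} \<in> edges T"
        using ab simplex_mono[OF T D(2), of "{a, b}"] by (simp add: edges_def)
      then show ?thesis using closed ab by blast
    qed (use ab in simp)
    then show "x \<in> ?E \<union> ?F" using x D(3) by blast
  qed
  moreover have "?E \<inter> ?F = {}"
    using realizationD(6)[OF T] by blast
  moreover have "?E \<noteq> {}"
  proof -
    obtain v where "v \<in> A" "v \<in> verts T" using A by blast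
    then have "barycenter {v} \<in> ?E" using vert[of v] by simp
    then show ?thesis by blast
  qed
  moreover have "?F \<noteq> {}"
  proof -
    obtain v where "v \<notin> A" "v \<in> verts T" using A ne by blast
    then have "barycenter {v} \<in> ?F" using vert[of v] by simp
    then show ?thesis by blast
  qed
  ultimately show False
    using conn closedin_subcomplex[of ?X A] closedin_subcomplex[of ?X "verts T - A"]
    unfolding connected_closedin by blast
qed

definition vertex_points :: "'v abs_complex \<Rightarrow> ('v \<Rightarrow> real) set" where
  "vertex_points T = (\<lambda>v. barycenter {v}) ` verts T"

lemma card_support_off_vertices:
  assumes T: "finite_abs_complex T" and x: "x \<in> realization T - vertex_points T"
  shows "2 \<le> card (support x)"
proof (rule ccontr)
  assume *: "\<not> ?thesis"
  have xX: "x \<in> realization T" using x by simp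
  note D = realizationD[OF T xX]
  have "card (support x) \<noteq> 0" using D by simp
  with * have "card (support x) = 1" by linarith
  then obtain v where v: "support x = {v}" by (auto simp: card_1_singleton_iff)
  then have "sum x {v} = 1" using sum_supported[OF T xX, of "{v}"] by simp
  then have "x u = barycenter {v} u" for u
    using v by (cases "u = v") (auto simp: barycenter_def)
  then have "x = barycenter {v}" by blast
  then show False using x v D(3) by (auto simp: vertex_points_def)
qed

lemma off_vertices_contains_edge:
  assumes T: "finite_abs_complex T" and x: "x \<in> realization T - vertex_points T"
  shows "\<exists>e\<in>edges T. e \<subseteq> support x"
proof -
  obtain e where "e \<subseteq> support x" "card e = 2"
    using card_support_off_vertices[OF assms] obtain_subset_with_card_n by metis
  then show ?thesis
    using x realizationD(2)[OF T, of x] simplex_mono[OF T] by (auto simp: edges_def)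
qed

lemma edge_in_face:
  assumes "two_faced T" "e \<in> edges T"
  shows "\<exists>f\<in>faces T. e \<subseteq> f"
proof -
  have "card {f \<in> faces T. e \<subseteq> f} = 2" using assms by (simp add: two_faced_def)
  then have "{f \<in> faces T. e \<subseteq> f} \<noteq> {}" by (metis card.empty zero_neq_numeral)
  then show ?thesis by blast
qed

text \<open>A nonempty locally planar set is infinite, so some point is not a vertex. Its support
  contains an edge, which lies in a face.\<close>

lemma faces_nonempty:
  assumes T: "finite_abs_complex T" and plane: "locally_planar (realization T)"
    and ne: "verts T \<noteq> {}"
  shows "faces T \<noteq> {}"
proof -
  obtain v where v: "v \<in> verts T" using ne by blast
  then have "barycenter {v} \<in> realization T"
    using T barycenter_in_realization[OF T, of "{v}"] by (auto simp: finite_abs_complex_def)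
  then have "infinite (realization T)"
    by (intro locally_planar_open_infinite[OF plane, of _ "barycenter {v}"]) auto
  moreover have "finite (vertex_points T)"
    using T by (simp add: finite_abs_complex_def vertex_points_def)
  ultimately have "\<not> realization T \<subseteq> vertex_points T"
    by (meson finite_subset)
  then obtain x where "x \<in> realization T - vertex_points T" by blast
  from off_vertices_contains_edge[OF T this]
  show ?thesis using edge_in_face[OF two_faced_if_locally_planar[OF T plane]] by blast
qed

text \<open>Faces may touch in a single vertex, which is why the vertices are deleted: two faces
  sharing a remaining point share an edge. The points over \<open>P\<close> and those over the other
  faces then form disjoint closed sets. They cover everything because supports have two or three
  elements and each edge lies in a face.\<close>

lemma dual_graph_connected:
  assumes T: "finite_abs_complex T" and plane: "locally_planar (realization T)"
    and conn: "connected (realization T)"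
    and P: "P \<subseteq> faces T" "P \<noteq> {}"
    and closed: "\<And>e f g. e \<in> edges T \<Longrightarrow> f \<in> P \<Longrightarrow> g \<in> faces T \<Longrightarrow> e \<subseteq> f \<Longrightarrow> e \<subseteq> g \<Longrightarrow> g \<in> P"
  shows "P = faces T"
proof (rule ccontr)
  assume ne: "P \<noteq> faces T"
  let ?Y = "realization T - vertex_points T"
  let ?E = "\<lambda>Q. \<Union>f\<in>Q. {x \<in> ?Y. support x \<subseteq> f}"
  have two: "two_faced T" by (rule two_faced_if_locally_planar[OF T plane])
  have "finite (vertex_points T)"
    using T by (simp add: finite_abs_complex_def vertex_points_def)
  then have "connected ?Y" by (rule connected_diff_finite[OF conn plane])
  moreover have "closedin (top_of_set ?Y) (?E Q)" if "Q \<subseteq> faces T" for Q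
    using that finite_simplices(2)[OF T] closedin_subcomplex[of ?Y]
    by (intro closedin_Union) (auto intro: finite_subset)
  moreover have "?Y \<subseteq> ?E P \<union> ?E (faces T - P)"
  proof
    fix x assume x: "x \<in> ?Y"
    have s: "support x \<in> simplices T" using x realizationD(2)[OF T] by blast
    have "\<exists>f\<in>faces T. support x \<subseteq> f"
    proof (cases "card (support x) = 3")
      case True
      then show ?thesis using s by (auto simp: faces_def)
    next
      case False
      then have "support x \<in> edges T"
        using card_support_off_vertices[OF T x] card_simplex_le_3[OF T plane s] s
        by (simp add: edges_def)
      then show ?thesis using edge_in_face[OF two] by blast
    qed
    then show "x \<in> ?E P \<union> ?E (faces T - P)" using x by blast
  qed
  moreover have "?E P \<inter> ?E (faces T - P) = {}"
  proof -
    have False if "x \<in> ?Y" "support x \<subseteq> f" "support x \<subseteq> g" "f \<in> P" "g \<in> faces T - P" for x f g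
      using off_vertices_contains_edge[OF T that(1)] that closed[of _ f g] by blast
    then show ?thesis by blast
  qed
  moreover have "?E Q \<noteq> {}" if Q: "Q \<subseteq> faces T" "Q \<noteq> {}" for Q
  proof -
    obtain f where f: "f \<in> Q" "f \<in> faces T" using Q by blast
    then have "f \<noteq> {}" using faceD(1)[of f T] by auto
    note b = barycenter_in_realization[OF T faceD(2)[OF f(2)] this]
    have "support (barycenter {v}) = {v}" for v :: 'a
      by (auto simp: barycenter_def)
    then have "barycenter f \<noteq> barycenter {v}" for v
      using b(2) faceD(1)[OF f(2)] by (metis card.empty card.insert empty_iff finite.emptyI numeral_eq_one_iff One_nat_def semiring_norm(84))
    then have "barycenter f \<in> {x \<in> ?Y. support x \<subseteq> f}"
      using b by (auto simp: vertex_points_def)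
    then show ?thesis using f(1) by blast
  qed
  moreover have "faces T - P \<subseteq> faces T" "faces T - P \<noteq> {}" using P ne by blast+
  ultimately have "connected ?Y" "closedin (top_of_set ?Y) (?E P)"
      "closedin (top_of_set ?Y) (?E (faces T - P))" "?Y \<subseteq> ?E P \<union> ?E (faces T - P)"
      "?E P \<inter> ?E (faces T - P) = {}" "?E P \<noteq> {}" "?E (faces T - P) \<noteq> {}"
    using P by simp_all
  then show False
    unfolding connected_closedin by blast
qed

section \<open>Counting cochains modulo 2\<close>

text \<open>The default simp rules turn addition of bits into \<open>XOR\<close>, which hides the additive group.\<close>

declare add_bit_eq_xor [simp del] mult_bit_eq_and [simp del]

lemma bit_add_self [simp]: "x + x = (0 :: bit)"
  by (cases x) simp_all

text \<open>The counting form of the first isomorphism theorem, which stands in for dimension counts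
  over the field with two elements: the nonempty fibres are translates of the kernel.\<close>

lemma card_eq_kernel_times_image:
  fixes f :: "'a::ab_group_add \<Rightarrow> 'b::ab_group_add"
  assumes A: "finite A" and sub: "\<And>x y. x \<in> A \<Longrightarrow> y \<in> A \<Longrightarrow> x - y \<in> A"
    and f: "\<And>x y. x \<in> A \<Longrightarrow> y \<in> A \<Longrightarrow> f (x - y) = f x - f y"
  shows "card A = card {x \<in> A. f x = 0} * card (f ` A)"
proof -
  let ?K = "{x \<in> A. f x = 0}"
  have fibre: "card {x \<in> A. f x = b} = card ?K" if b: "b \<in> f ` A" for b
  proof -
    obtain a where a: "a \<in> A" "b = f a" using b by blast
    have "bij_betw (\<lambda>x. x - a) {x \<in> A. f x = b} ?K"
    proof (rule bij_betwI[where g = "\<lambda>k. k + a"])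
      have 0: "0 \<in> A" "f 0 = 0" using sub[OF a(1) a(1)] f[OF a(1) a(1)] by simp_all
      then have "- a \<in> A" "f (- a) = - f a" using sub[OF 0(1) a(1)] f[OF 0(1) a(1)] by simp_all
      then have "k + a \<in> A" "f (k + a) = f k + f a" if "k \<in> A" for k
        using sub[of k "- a"] f[of k "- a"] that by simp_all
      then show "(\<lambda>k. k + a) \<in> ?K \<rightarrow> {x \<in> A. f x = b}"
        using a by auto
    qed (use sub f a in auto)
    then show ?thesis by (rule bij_betw_same_card)
  qed
  have "card A = (\<Sum>b\<in>f ` A. card {x \<in> A. f x = b})"
    using sum.image_gen[OF A, of "\<lambda>_. 1::nat" f] by simp
  also have "\<dots> = card ?K * card (f ` A)"
    using fibre by simp
  finally show ?thesis .
qed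

text \<open>Extension by 0 makes this a finite group under pointwise addition when \<open>A\<close>
  is finite.\<close>

definition cochains :: "'s set \<Rightarrow> ('s \<Rightarrow> bit) set" where
  "cochains A = {\<phi>. \<forall>s. s \<notin> A \<longrightarrow> \<phi> s = 0}"

lemma card_cochains:
  assumes "finite A"
  shows "finite (cochains A)" "card (cochains A) = 2 ^ card A"
proof -
  have "bij_betw (\<lambda>\<phi>. {s. \<phi> s = 1}) (cochains A) (Pow A)"
  proof (rule bij_betwI[where g = "\<lambda>B s. if s \<in> B then 1 else 0"])
    show "(\<lambda>s. if s \<in> {s. \<phi> s = 1} then 1 else 0) = \<phi>" for \<phi> :: "'a \<Rightarrow> bit"
      by (rule ext) simp
  qed (auto simp: cochains_def)
  then show "finite (cochains A)" "card (cochains A) = 2 ^ card A"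
    using assms by (auto simp: bij_betw_finite bij_betw_same_card card_Pow)
qed

lemma cochains_diff: "\<phi> \<in> cochains A \<Longrightarrow> \<psi> \<in> cochains A \<Longrightarrow> \<phi> - \<psi> \<in> cochains A"
  by (simp add: cochains_def)

definition coboundary0 :: "'v abs_complex \<Rightarrow> ('v \<Rightarrow> bit) \<Rightarrow> 'v set \<Rightarrow> bit" where
  "coboundary0 T h = (\<lambda>e. if e \<in> edges T then \<Sum>v\<in>e. h v else 0)"

definition coboundary1 :: "'v abs_complex \<Rightarrow> ('v set \<Rightarrow> bit) \<Rightarrow> 'v set \<Rightarrow> bit" where
  "coboundary1 T \<phi> = (\<lambda>f. if f \<in> faces T then \<Sum>e | e \<in> edges T \<and> e \<subseteq> f. \<phi> e else 0)"

definition cocycles :: "'v abs_complex \<Rightarrow> ('v set \<Rightarrow> bit) set" where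
  "cocycles T = {\<phi> \<in> cochains (edges T). coboundary1 T \<phi> = 0}"

definition coboundaries :: "'v abs_complex \<Rightarrow> ('v set \<Rightarrow> bit) set" where
  "coboundaries T = coboundary0 T ` cochains (verts T)"

lemma coboundary0_diff: "coboundary0 T (g - h) = coboundary0 T g - coboundary0 T h"
  by (auto simp: coboundary0_def fun_eq_iff sum.distrib)

lemma coboundary1_diff: "coboundary1 T (g - h) = coboundary1 T g - coboundary1 T h"
  by (auto simp: coboundary1_def fun_eq_iff sum.distrib)

text \<open>By connectedness of the 1-skeleton, the kernel of \<open>coboundary0\<close> consists of
  the two functions constant on the vertices.\<close>

lemma card_coboundaries:
  assumes T: "finite_abs_complex T" and conn: "connected (realization T)" and ne: "verts T \<noteq> {}"
  shows "2 * card (coboundaries T) = 2 ^ card (verts T)"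
proof -
  let ?C = "cochains (verts T)" and ?one = "\<lambda>v. if v \<in> verts T then 1 else 0 :: bit"
  have fin: "finite (verts T)" using T by (simp add: finite_abs_complex_def)
  have "{h \<in> ?C. coboundary0 T h = 0} = {0, ?one}"
  proof (intro equalityI subsetI)
    fix h assume h: "h \<in> {h \<in> ?C. coboundary0 T h = 0}"
    have eq: "h a = h b" if "{a, b} \<in> edges T" for a b
    proof -
      have "a \<noteq> b" using edgeD(1)[OF that] by auto
      moreover have "coboundary0 T h {a, b} = 0" using h by simp
      ultimately have "h a + h b = 0" using that by (simp add: coboundary0_def)
      then show ?thesis by (cases "h a"; cases "h b") simp_all
    qed
    let ?A = "{v \<in> verts T. h v = 1}"
    have out: "h v = 0" if "v \<notin> verts T" for v using h that by (simp add: cochains_def)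
    show "h \<in> {0, ?one}"
    proof (cases "?A = {}")
      case True
      then have "h v = 0" for v using out[of v] by (cases "v \<in> verts T") auto
      then show ?thesis by (simp add: fun_eq_iff)
    next
      case False
      have "?A = verts T"
      proof (rule one_skeleton_connected[OF T conn _ False])
        fix a b assume ab: "a \<in> ?A" "{a, b} \<in> edges T"
        have "b \<in> verts T" using simplex_subset_verts(1)[OF T edgeD(2)[OF ab(2)]] by simp
        then show "b \<in> ?A" using ab eq[OF ab(2)] by simp
      qed auto
      then have "h = ?one" using out by (auto simp: fun_eq_iff)
      then show ?thesis by simp
    qed
  next
    fix h assume h: "h \<in> {0, ?one}"
    have "coboundary0 T ?one e = 0" for e
    proof (cases "e \<in> edges T")
      case True
      have "(\<Sum>v\<in>e. ?one v) = (\<Sum>v\<in>e. 1)"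
        using simplex_subset_verts(1)[OF T edgeD(2)[OF True]] by (intro sum.cong) auto
      then show ?thesis using True edgeD(1)[OF True] by (simp add: coboundary0_def)
    qed (simp add: coboundary0_def)
    then have "coboundary0 T ?one = 0" by (intro ext) (simp only: zero_fun_apply)
    moreover have "coboundary0 T 0 = 0" by (intro ext) (simp add: coboundary0_def)
    moreover have "0 \<in> ?C" "?one \<in> ?C" by (simp_all add: cochains_def)
    ultimately show "h \<in> {h \<in> ?C. coboundary0 T h = 0}"
      using h by (elim insertE) simp_all
  qed
  moreover have "?one \<noteq> 0" using ne by (auto simp: fun_eq_iff)
  ultimately have "card {h \<in> ?C. coboundary0 T h = 0} = 2" by simp
  moreover have "card ?C = card {h \<in> ?C. coboundary0 T h = 0} * card (coboundary0 T ` ?C)"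
    by (rule card_eq_kernel_times_image)
      (simp_all only: card_cochains(1)[OF fin] cochains_diff coboundary0_diff)
  ultimately show ?thesis
    using card_cochains(2)[OF fin] by (simp add: coboundaries_def)
qed

text \<open>This is |H^2| = 2: the image of \<open>coboundary1\<close> consists of the 2-cochains
  with total sum 0, hence has index 2 and order 2 ^ (|F| - 1). The cocycles are the kernel of the
  same map on 2 ^ |E| cochains.\<close>

lemma card_cocycles:
  assumes T: "finite_abs_complex T" and plane: "locally_planar (realization T)"
    and conn: "connected (realization T)" and ne: "verts T \<noteq> {}"
  shows "card (cocycles T) * 2 ^ card (faces T) = 2 * 2 ^ card (edges T)"
proof -
  let ?I = "coboundary1 T ` cochains (edges T)"
  let ?single = "\<lambda>s. (\<lambda>t. if t = s then 1 else 0) :: 'a set \<Rightarrow> bit"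
  let ?\<sigma> = "\<lambda>\<psi> :: 'a set \<Rightarrow> bit. \<Sum>f\<in>faces T. \<psi> f"
  note fin = finite_simplices[OF T]
  have two: "two_faced T" by (rule two_faced_if_locally_planar[OF T plane])
  obtain f0 where f0: "f0 \<in> faces T" using faces_nonempty[OF T plane ne] by blast
  have I_sum: "a + b \<in> ?I" if ab: "a \<in> ?I" "b \<in> ?I" for a b
  proof -
    obtain x y where xy: "a = coboundary1 T x" "b = coboundary1 T y"
      "x \<in> cochains (edges T)" "y \<in> cochains (edges T)"
      using ab by blast
    have "a + b = coboundary1 T (x - y)"
      unfolding coboundary1_diff xy(1,2) by (rule ext) simp
    then show ?thesis using cochains_diff[OF xy(3,4)] by (rule image_eqI)
  qed
  \<comment> \<open>The coboundary of the indicator of an edge is the sum of the indicators of its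
    two faces.\<close>
  have adjacent: "?single f + ?single g \<in> ?I"
    if e: "e \<in> edges T" "e \<subseteq> f" "e \<subseteq> g" and fg: "f \<in> faces T" "g \<in> faces T" "f \<noteq> g" for e f g
  proof -
    have "{h \<in> faces T. e \<subseteq> h} = {f, g}"
    proof (rule card_seteq[symmetric])
      show "card {h \<in> faces T. e \<subseteq> h} \<le> card {f, g}"
        using two e fg by (simp add: two_faced_def)
    qed (use fin e fg in auto)
    moreover have "coboundary1 T (?single e) h = (if h \<in> faces T \<and> e \<subseteq> h then 1 else 0)" for h
      using fin e(1) by (simp add: coboundary1_def sum.delta)
    ultimately have "coboundary1 T (?single e) = ?single f + ?single g"
      using fg by (auto simp: fun_eq_iff)
    moreover have "?single e \<in> cochains (edges T)"
      using e(1) by (simp add: cochains_def)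
    ultimately show ?thesis by (metis (no_types, lifting) image_eqI)
  qed
  have "0 \<in> ?I"
  proof (rule image_eqI)
    show "0 = coboundary1 T 0" by (auto simp: coboundary1_def fun_eq_iff)
  qed (simp add: cochains_def)
  have pairs: "?single f0 + ?single f \<in> ?I" if "f \<in> faces T" for f
  proof -
    have "{f \<in> faces T. ?single f0 + ?single f \<in> ?I} = faces T"
    proof (rule dual_graph_connected[OF T plane conn])
      have "?single f0 + ?single f0 = 0" by (simp add: fun_eq_iff)
      then have "f0 \<in> {f \<in> faces T. ?single f0 + ?single f \<in> ?I}"
        using f0 \<open>0 \<in> ?I\<close> by simp
      then show "{f \<in> faces T. ?single f0 + ?single f \<in> ?I} \<noteq> {}" by blast
    next
      fix e f g assume *: "e \<in> edges T" "f \<in> {f \<in> faces T. ?single f0 + ?single f \<in> ?I}"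
        "g \<in> faces T" "e \<subseteq> f" "e \<subseteq> g"
      show "g \<in> {f \<in> faces T. ?single f0 + ?single f \<in> ?I}"
      proof (cases "f = g")
        case False
        have "?single f0 + ?single f \<in> ?I" "?single f + ?single g \<in> ?I"
          using * False adjacent[of e f g] by simp_all
        then have "(?single f0 + ?single f) + (?single f + ?single g) \<in> ?I"
          by (rule I_sum)
        moreover have "(?single f0 + ?single f) + (?single f + ?single g) = ?single f0 + ?single g"
          by (simp add: fun_eq_iff)
        ultimately show ?thesis using * by simp
      qed (use * in simp)
    qed auto
    then show ?thesis using that by blast
  qed
  \<comment> \<open>Each edge value is counted once in each of its two faces and cancels.\<close>
  have sum_zero: "?\<sigma> \<psi> = 0" if \<psi>: "\<psi> \<in> ?I" for \<psi>
  proof -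
    obtain \<phi> where "\<psi> = coboundary1 T \<phi>" using \<psi> by blast
    then have "?\<sigma> \<psi> = (\<Sum>f\<in>faces T. \<Sum>e | e \<in> edges T \<and> e \<subseteq> f. \<phi> e)"
      by (simp add: coboundary1_def)
    also have "\<dots> = (\<Sum>e\<in>edges T. \<Sum>f | f \<in> faces T \<and> e \<subseteq> f. \<phi> e)"
      using fin(2,3) by (rule sum.swap_restrict)
    also have "\<dots> = 0"
      using two by (intro sum.neutral) (simp add: two_faced_def)
    finally show ?thesis .
  qed
  \<comment> \<open>Expand the cochain in the elements \<open>?single f0 + ?single f\<close>; the
    copies of \<open>?single f0\<close> add up to the total sum, which is 0.\<close>
  have even: "\<psi> \<in> ?I" if \<psi>: "\<psi> \<in> cochains (faces T)" "?\<sigma> \<psi> = 0" for \<psi>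
  proof -
    have "(\<Sum>f\<in>A. if \<psi> f = 1 then ?single f0 + ?single f else 0) \<in> ?I" if "A \<subseteq> faces T" for A
      using finite_subset[OF that fin(2)] that
    proof (induction rule: finite_induct)
      case (insert f A)
      have f: "f \<in> faces T" "A \<subseteq> faces T" using insert.prems by auto
      have "(if \<psi> f = 1 then ?single f0 + ?single f else 0) \<in> ?I"
        using pairs[OF f(1)] \<open>0 \<in> ?I\<close> by (cases "\<psi> f = 1") (simp_all only: if_True if_False simp_thms)
      from I_sum[OF this insert.IH[OF f(2)]] show ?case
        by (simp only: sum.insert[OF insert.hyps])
    qed (use \<open>0 \<in> ?I\<close> in simp)
    moreover have "(\<Sum>f\<in>faces T. if \<psi> f = 1 then ?single f0 + ?single f else 0) = \<psi>"
    proof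
      fix g
      have "(\<Sum>f\<in>A. if \<psi> f = 1 then ?single f0 + ?single f else 0) g =
          ?single f0 g * (\<Sum>f\<in>A. \<psi> f) + (\<Sum>f\<in>A. if f = g then \<psi> f else 0)" if "finite A" for A
        using that
      proof (induction A)
        case (insert f A)
        then show ?case by (cases "\<psi> f") (auto simp: algebra_simps)
      qed simp
      from this[OF fin(2)] show "(\<Sum>f\<in>faces T. if \<psi> f = 1 then ?single f0 + ?single f else 0) g = \<psi> g"
        using \<psi> fin by (auto simp: cochains_def)
    qed
    ultimately show ?thesis by (metis (no_types, lifting) order_refl)
  qed
  have "{\<psi> \<in> cochains (faces T). ?\<sigma> \<psi> = 0} = ?I"
  proof -
    have "?I \<subseteq> cochains (faces T)" by (auto simp: cochains_def coboundary1_def)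
    then show ?thesis using even sum_zero by blast
  qed
  moreover have "?\<sigma> ` cochains (faces T) = UNIV"
  proof -
    have "?single f0 \<in> cochains (faces T)" "?\<sigma> (?single f0) = 1"
      using f0 fin by (simp_all add: cochains_def)
    then have "1 \<in> ?\<sigma> ` cochains (faces T)" by (metis (no_types, lifting) image_eqI)
    moreover have "0 \<in> ?\<sigma> ` cochains (faces T)"
      by (rule image_eqI[of _ _ 0]) (simp_all add: cochains_def)
    ultimately have "b \<in> ?\<sigma> ` cochains (faces T)" for b by (cases b) simp_all
    then show ?thesis by blast
  qed
  moreover have "(UNIV :: bit set) = {0, 1}"
    by (auto intro: bit.exhaust)
  moreover have "card (cochains (faces T)) =
      card {\<psi> \<in> cochains (faces T). ?\<sigma> \<psi> = 0} * card (?\<sigma> ` cochains (faces T))"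
    using card_cochains(1)[OF fin(2)] cochains_diff
    by (rule card_eq_kernel_times_image) (simp_all add: sum.distrib)
  moreover have "card {0 :: bit, 1} = 2" by simp
  ultimately have "2 ^ card (faces T) = card ?I * 2"
    using card_cochains(2)[OF fin(2)] by metis
  moreover have "card (cochains (edges T)) =
      card {\<phi> \<in> cochains (edges T). coboundary1 T \<phi> = 0} * card ?I"
    by (rule card_eq_kernel_times_image)
      (simp_all only: card_cochains(1)[OF fin(3)] cochains_diff coboundary1_diff)
  then have "2 ^ card (edges T) = card (cocycles T) * card ?I"
    using card_cochains(2)[OF fin(3)] by (simp add: cocycles_def)
  ultimately show ?thesis by simp
qed

section \<open>Cocycles on pairs of nearby points\<close>

text \<open>The l1 distance of barycentric coordinates. Unlike the weighted series that serves as
  \<open>dist\<close> on functions, it is easy to estimate along segments.\<close>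

definition vdist :: "'v set \<Rightarrow> ('v \<Rightarrow> real) \<Rightarrow> ('v \<Rightarrow> real) \<Rightarrow> real" where
  "vdist V x y = (\<Sum>v\<in>V. \<bar>x v - y v\<bar>)"

lemma vdist_triangle: "vdist V x z \<le> vdist V x y + vdist V y z"
  unfolding vdist_def sum.distrib[symmetric] by (intro sum_mono) linarith

lemma vdist_commute: "vdist V x y = vdist V y x"
  unfolding vdist_def by (intro sum.cong) (auto simp: abs_minus_commute)

lemma vdist_self [simp]: "vdist V x x = 0"
  by (simp add: vdist_def)

lemma vdist_nonneg: "0 \<le> vdist V x y"
  by (simp add: vdist_def sum_nonneg)

lemma abs_diff_le_vdist: "finite V \<Longrightarrow> v \<in> V \<Longrightarrow> \<bar>x v - y v\<bar> \<le> vdist V x y"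
  unfolding vdist_def by (rule member_le_sum) auto

text \<open>Each term of the series defining \<open>dist\<close> is at most \<open>(1/2)^n\<close>
  times the l1 distance, and these weights sum to 2.\<close>

lemma dist_le_vdist:
  fixes x y :: "nat \<Rightarrow> real"
  assumes V: "finite V" and xy: "support x \<subseteq> V" "support y \<subseteq> V"
  shows "dist x y \<le> 2 * vdist V x y"
proof -
  have geo: "(\<lambda>n. (1/2)^n * vdist V x y) sums (2 * vdist V x y)"
    using sums_mult2[OF geometric_sums[of "1/2 :: real"], of "vdist V x y"] by simp
  have le: "(1/2)^n * min (dist (x (from_nat n)) (y (from_nat n))) 1 \<le> (1/2)^n * vdist V x y" for n
  proof (rule mult_left_mono)
    have "dist (x k) (y k) \<le> vdist V x y" for k
    proof (cases "k \<in> V")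
      case True
      then show ?thesis using abs_diff_le_vdist[OF V, of k x y] by (simp add: dist_real_def)
    next
      case False
      then have "x k = 0" "y k = 0" using xy by auto
      then show ?thesis by (simp add: vdist_nonneg)
    qed
    then show "min (dist (x (from_nat n)) (y (from_nat n))) 1 \<le> vdist V x y"
      by (simp add: min.coboundedI1)
  qed simp
  have "summable (\<lambda>n. (1/2)^n * min (dist (x (from_nat n)) (y (from_nat n))) 1)"
    by (rule summable_comparison_test'[OF sums_summable[OF geo]]) (use le in simp)
  then show ?thesis
    unfolding dist_fun_def using sums_unique[OF geo] sums_summable[OF geo] le
    by (simp only: suminf_le)
qed

text \<open>One comparison of the metrics suffices: \<open>dist\<close> is bounded by the l1
  distance on the domain, and on the target the finitely many coordinates in \<open>W\<close> are
  uniformly continuous one by one.\<close>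

lemma uniformly_continuous_vdist:
  fixes h :: "(nat \<Rightarrow> real) \<Rightarrow> 'w \<Rightarrow> real"
  assumes X: "compact X" "continuous_on X h" and V: "finite V" "\<And>x. x \<in> X \<Longrightarrow> support x \<subseteq> V"
    and W: "finite W" and e: "0 < e"
  shows "\<exists>d>0. \<forall>x\<in>X. \<forall>y\<in>X. vdist V x y < d \<longrightarrow> vdist W (h x) (h y) < e"
proof -
  define e' where "e' = e / (1 + real (card W))"
  have e': "0 < e'" using e by (simp add: e'_def)
  have "\<exists>d>0. \<forall>x\<in>X. \<forall>y\<in>X. dist x y < d \<longrightarrow> \<bar>h x w - h y w\<bar> < e'" for w
  proof -
    have "uniformly_continuous_on X (\<lambda>x. h x w)"
      by (rule compact_uniformly_continuous[OF continuous_on_product_then_coordinatewise[OF X(2)] X(1)])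
    then obtain d where "d > 0" "\<forall>x\<in>X. \<forall>x'\<in>X. dist x' x < d \<longrightarrow> dist (h x' w) (h x w) < e'"
      using e' unfolding uniformly_continuous_on_def by blast
    then show ?thesis by (auto simp: dist_real_def)
  qed
  then obtain d where d: "\<And>w. 0 < d w"
    "\<And>w x y. x \<in> X \<Longrightarrow> y \<in> X \<Longrightarrow> dist x y < d w \<Longrightarrow> \<bar>h x w - h y w\<bar> < e'"
    by metis
  define m where "m = Min (insert 1 (d ` W))"
  have m: "0 < m" "\<And>w. w \<in> W \<Longrightarrow> m \<le> d w"
    using W d(1) by (auto simp: m_def)
  show ?thesis
  proof (intro exI conjI ballI impI)
    show "0 < m / 2" using m by simp
    fix x y assume xy: "x \<in> X" "y \<in> X" "vdist V x y < m / 2"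
    then have "dist x y < m" using dist_le_vdist[OF V(1) V(2) V(2), of x y] by simp
    then have "\<bar>h x w - h y w\<bar> \<le> e'" if "w \<in> W" for w
      using d(2)[OF xy(1,2), of w] m(2)[OF that] by simp
    then have "vdist W (h x) (h y) \<le> (\<Sum>w\<in>W. e')"
      unfolding vdist_def by (intro sum_mono)
    also have "\<dots> < e" using e by (simp add: e'_def field_simps)
    finally show "vdist W (h x) (h y) < e" .
  qed
qed

text \<open>A vertex of largest weight has weight at least \<open>1 / |V|\<close>, so it stays in the support of every
  nearby point. An arbitrary vertex of the support would not.\<close>

definition dominant :: "'v abs_complex \<Rightarrow> ('v \<Rightarrow> real) \<Rightarrow> 'v" where
  "dominant T x = (SOME v. v \<in> verts T \<and> (\<forall>u\<in>verts T. x u \<le> x v))"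

lemma dominant:
  assumes T: "finite_abs_complex T" and x: "x \<in> realization T"
  shows "dominant T x \<in> verts T" "1 \<le> real (card (verts T)) * x (dominant T x)"
    "dominant T x \<in> support x"
proof -
  have fin: "finite (verts T)" using T by (simp add: finite_abs_complex_def)
  have ne: "verts T \<noteq> {}" using realizationD(3,6)[OF T x] by blast
  then have "Max (x ` verts T) \<in> x ` verts T" using fin by simp
  then obtain v where "v \<in> verts T" "x v = Max (x ` verts T)" by (auto simp: image_iff)
  then have "v \<in> verts T \<and> (\<forall>u\<in>verts T. x u \<le> x v)" using fin by simp
  then have *: "dominant T x \<in> verts T \<and> (\<forall>u\<in>verts T. x u \<le> x (dominant T x))"
    unfolding dominant_def by (rule someI)
  then show "dominant T x \<in> verts T" by simp
  have "sum x (verts T) \<le> (\<Sum>u\<in>verts T. x (dominant T x))"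
    using * by (intro sum_mono) simp
  then show le: "1 \<le> real (card (verts T)) * x (dominant T x)"
    using realizationD(5)[OF T x] by simp
  show "dominant T x \<in> support x"
    using le by auto
qed

lemma dominant_near:
  assumes T: "finite_abs_complex T" and x: "x \<in> realization T" "y \<in> realization T"
    and near: "vdist (verts T) x y < 1 / real (card (verts T))"
  shows "dominant T x \<in> support y"
proof -
  let ?n = "real (card (verts T))"
  have fin: "finite (verts T)" using T by (simp add: finite_abs_complex_def)
  note dx = dominant[OF T x(1)]
  have "0 < ?n" using dx(1) fin by (auto simp: card_gt_0_iff)
  then have "1 / ?n \<le> x (dominant T x)"
    using dx(2) by (simp add: field_simps)
  moreover have "\<bar>x (dominant T x) - y (dominant T x)\<bar> < 1 / ?n"
    using abs_diff_le_vdist[OF fin dx(1), of x y] near by simp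
  ultimately have "y (dominant T x) \<noteq> 0" by auto
  then show ?thesis by simp
qed

lemma coboundary1_triangle:
  assumes T: "finite_abs_complex T" and f: "{u, v, w} \<in> faces T" and ne: "u \<noteq> v" "v \<noteq> w" "u \<noteq> w"
  shows "coboundary1 T \<phi> {u, v, w} = \<phi> {u, v} + (\<phi> {v, w} + \<phi> {u, w})"
proof -
  have sub: "{u, v} \<in> edges T" "{v, w} \<in> edges T" "{u, w} \<in> edges T"
    using ne simplex_mono[OF T faceD(2)[OF f]] by (simp_all add: edges_def)
  have "{e \<in> edges T. e \<subseteq> {u, v, w}} = {{u, v}, {v, w}, {u, w}}"
  proof (intro equalityI subsetI)
    fix e assume e: "e \<in> {e \<in> edges T. e \<subseteq> {u, v, w}}"
    then obtain a b where "e = {a, b}" "a \<noteq> b" using edgeD(1)[of e T] by (auto simp: card_2_iff)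
    then show "e \<in> {{u, v}, {v, w}, {u, w}}" using e by (auto simp: insert_commute)
  qed (use sub in auto)
  moreover have "{u, v} \<noteq> {v, w}" "{u, v} \<noteq> {u, w}" "{v, w} \<noteq> {u, w}"
    using ne by (auto simp: doubleton_eq_iff)
  ultimately show ?thesis using f by (simp add: coboundary1_def)
qed

text \<open>Repeated vertices are included, since a singleton is not an edge and cochains vanish on
  it. They do occur: nearby points often have the same dominant vertex.\<close>

lemma cocycle_triangle:
  assumes T: "finite_abs_complex T" and \<phi>: "\<phi> \<in> cocycles T" and s: "s \<in> simplices T"
    and uvw: "u \<in> s" "v \<in> s" "w \<in> s"
  shows "\<phi> {u, v} + \<phi> {v, w} = \<phi> {u, w}"
proof -
  have single: "\<phi> {a} = 0" for a
    using \<phi> by (auto simp: cocycles_def cochains_def edges_def)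
  consider "u = v" | "v = w" | "u = w" | "u \<noteq> v" "v \<noteq> w" "u \<noteq> w" by blast
  then show ?thesis
  proof cases
    case 4
    have f: "{u, v, w} \<in> faces T"
      using 4 uvw simplex_mono[OF T s, of "{u, v, w}"] by (simp add: faces_def)
    have "coboundary1 T \<phi> {u, v, w} = 0" using \<phi> by (simp add: cocycles_def)
    then have "\<phi> {u, v} + (\<phi> {v, w} + \<phi> {u, w}) = 0"
      using coboundary1_triangle[OF T f] 4 by simp
    then show ?thesis
      by (cases "\<phi> {u, v}"; cases "\<phi> {v, w}"; cases "\<phi> {u, w}") simp_all
  qed (simp_all add: single insert_commute)
qed

text \<open>The Alexander-Spanier 1-cocycle condition mod 2 at scale \<open>\<delta>\<close>; values
  on distant pairs are unconstrained.\<close>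

definition local_cocycle :: "'v abs_complex \<Rightarrow> real \<Rightarrow> (('v \<Rightarrow> real) \<Rightarrow> ('v \<Rightarrow> real) \<Rightarrow> bit) \<Rightarrow> bool" where
  "local_cocycle T \<delta> g \<longleftrightarrow> (\<forall>x\<in>realization T. \<forall>y\<in>realization T. \<forall>z\<in>realization T.
     vdist (verts T) x y < \<delta> \<longrightarrow> vdist (verts T) y z < \<delta> \<longrightarrow> vdist (verts T) x z < \<delta> \<longrightarrow>
     g x y + g y z = g x z)"

lemma local_cocycleD:
  assumes "local_cocycle T \<delta> g" "x \<in> realization T" "y \<in> realization T" "z \<in> realization T"
    "vdist (verts T) x y < \<delta>" "vdist (verts T) y z < \<delta>" "vdist (verts T) x z < \<delta>"
  shows "g x y + g y z = g x z"
  using assms by (simp add: local_cocycle_def)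

lemma local_cocycle_self:
  assumes "local_cocycle T \<delta> g" "x \<in> realization T" "0 < \<delta>"
  shows "g x x = 0"
  using local_cocycleD[OF assms(1,2,2,2)] assms(3) by simp

definition spread :: "'v abs_complex \<Rightarrow> ('v set \<Rightarrow> bit) \<Rightarrow> ('v \<Rightarrow> real) \<Rightarrow> ('v \<Rightarrow> real) \<Rightarrow> bit" where
  "spread T \<phi> x y = \<phi> {dominant T x, dominant T y}"

text \<open>At this scale the dominant vertices of all three points lie in the support of
  \<open>x\<close>, so the cocycle identity holds within one simplex although
  \<open>dominant\<close> is not continuous.\<close>

lemma local_cocycle_spread:
  assumes T: "finite_abs_complex T" and \<phi>: "\<phi> \<in> cocycles T"
  shows "local_cocycle T (1 / real (card (verts T))) (spread T \<phi>)"
  unfolding local_cocycle_def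
proof (intro ballI impI)
  fix x y z assume xyz: "x \<in> realization T" "y \<in> realization T" "z \<in> realization T"
    and near: "vdist (verts T) x y < 1 / real (card (verts T))"
      "vdist (verts T) y z < 1 / real (card (verts T))"
      "vdist (verts T) x z < 1 / real (card (verts T))"
  have "dominant T x \<in> support x" "dominant T y \<in> support x" "dominant T z \<in> support x"
    using dominant(3)[OF T xyz(1)] dominant_near[OF T xyz(2,1)] dominant_near[OF T xyz(3,1)] near
      vdist_commute by metis+
  then show "spread T \<phi> x y + spread T \<phi> y z = spread T \<phi> x z"
    unfolding spread_def using realizationD(2)[OF T xyz(1)] by (intro cocycle_triangle[OF T \<phi>])
qed

section \<open>Discrete integration along subdivided segments\<close>

definition segment_point :: "nat \<Rightarrow> ('v \<Rightarrow> real) \<Rightarrow> ('v \<Rightarrow> real) \<Rightarrow> nat \<Rightarrow> 'v \<Rightarrow> real" where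
  "segment_point N c x i = (\<lambda>v. (1 - real i / real N) * c v + real i / real N * x v)"

lemma segment_point_0 [simp]: "segment_point N c x 0 = c"
  by (simp add: segment_point_def)

lemma segment_point_N [simp]: "0 < N \<Longrightarrow> segment_point N c x N = x"
  by (simp add: segment_point_def)

lemma segment_point_self [simp]: "segment_point N c c i = c"
  by (simp add: segment_point_def algebra_simps)

lemma support_segment_point:
  assumes "support c \<subseteq> s" "support x \<subseteq> s"
  shows "support (segment_point N c x i) \<subseteq> s"
proof -
  have "segment_point N c x i v = 0" if "v \<notin> s" for v
  proof -
    have "c v = 0" "x v = 0" using assms that by auto
    then show ?thesis by (simp add: segment_point_def)
  qed
  then show ?thesis by blast
qed

lemma segment_point_in_realization:
  assumes "finite_abs_complex T" "s \<in> simplices T" "c \<in> realization T" "x \<in> realization T"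
    "support c \<subseteq> s" "support x \<subseteq> s" "i \<le> N" "0 < N"
  shows "segment_point N c x i \<in> realization T"
  unfolding segment_point_def
  using assms by (intro convex_combination_in_realization[where s = s]) auto

text \<open>Coordinates are nonnegative with sum 1, so two points are at l1 distance at most
  2.\<close>

lemma vdist_segment_step:
  assumes T: "finite_abs_complex T" and x: "c \<in> realization T" "x \<in> realization T" and N: "0 < N"
  shows "vdist (verts T) (segment_point N c x i) (segment_point N c x (Suc i)) \<le> 2 / real N"
proof -
  have eq: "segment_point N c x i v - segment_point N c x (Suc i) v = (c v - x v) / real N" for v
    using N by (simp add: segment_point_def field_simps)
  have "vdist (verts T) (segment_point N c x i) (segment_point N c x (Suc i)) =
      (\<Sum>v\<in>verts T. \<bar>c v - x v\<bar> / real N)"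
    unfolding vdist_def eq by (simp add: abs_divide)
  also have "\<dots> \<le> (\<Sum>v\<in>verts T. (c v + x v) / real N)"
  proof (intro sum_mono divide_right_mono)
    fix v show "\<bar>c v - x v\<bar> \<le> c v + x v"
      using realizationD(1)[OF T x(1), of v] realizationD(1)[OF T x(2), of v] by linarith
  qed simp
  also have "\<dots> = 2 / real N"
    using realizationD(5)[OF T x(1)] realizationD(5)[OF T x(2)]
    by (simp add: sum.distrib flip: sum_divide_distrib)
  finally show ?thesis .
qed

lemma vdist_segments:
  assumes N: "0 < N" and i: "i \<le> N"
  shows "vdist V (segment_point N c x i) (segment_point N c y i) \<le> vdist V x y"
  unfolding vdist_def
proof (rule sum_mono)
  fix v
  have "segment_point N c x i v - segment_point N c y i v = (real i / real N) * (x v - y v)"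
    unfolding segment_point_def right_diff_distrib by simp
  then have "\<bar>segment_point N c x i v - segment_point N c y i v\<bar> = (real i / real N) * \<bar>x v - y v\<bar>"
    by (simp add: abs_mult)
  also have "\<dots> \<le> 1 * \<bar>x v - y v\<bar>"
    using i N by (intro mult_right_mono) auto
  finally show "\<bar>segment_point N c x i v - segment_point N c y i v\<bar> \<le> \<bar>x v - y v\<bar>" by simp
qed

text \<open>A discrete line integral of \<open>g\<close> along the segment from \<open>c\<close> to
  \<open>x\<close>.\<close>

definition chain_sum ::
  "(('v \<Rightarrow> real) \<Rightarrow> ('v \<Rightarrow> real) \<Rightarrow> bit) \<Rightarrow> nat \<Rightarrow> ('v \<Rightarrow> real) \<Rightarrow> ('v \<Rightarrow> real) \<Rightarrow> bit" where
  "chain_sum g N c x = (\<Sum>i<N. g (segment_point N c x i) (segment_point N c x (Suc i)))"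

text \<open>Two chains joined by rungs bound a strip of squares. Each square is cut by the diagonal
  from \<open>p n\<close> to \<open>q (Suc n)\<close>, and the cocycle identity holds on both
  triangles; the bound \<open>\<delta> / 2\<close> on the sides keeps the diagonal below
  \<open>\<delta>\<close>.\<close>

lemma ladder:
  assumes g: "local_cocycle T \<delta> g"
    and X: "\<And>i. i \<le> N \<Longrightarrow> p i \<in> realization T" "\<And>i. i \<le> N \<Longrightarrow> q i \<in> realization T"
    and near: "\<And>i. i \<le> N \<Longrightarrow> vdist (verts T) (p i) (q i) < \<delta> / 2"
      "\<And>i. i < N \<Longrightarrow> vdist (verts T) (p i) (p (Suc i)) < \<delta> / 2"
      "\<And>i. i < N \<Longrightarrow> vdist (verts T) (q i) (q (Suc i)) < \<delta> / 2"
    and n: "n \<le> N"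
  shows "(\<Sum>i<n. g (p i) (p (Suc i))) + g (p n) (q n) = g (p 0) (q 0) + (\<Sum>i<n. g (q i) (q (Suc i)))"
  using n
proof (induction n)
  case (Suc n)
  let ?d = "vdist (verts T)"
  have half: "a < \<delta>" if "a < \<delta> / 2" "0 \<le> a" for a :: real using that by simp
  have 1: "?d (p n) (q n) < \<delta>" "?d (q n) (q (Suc n)) < \<delta>" "?d (p n) (p (Suc n)) < \<delta>"
    "?d (p (Suc n)) (q (Suc n)) < \<delta>"
    using half[OF near(1) vdist_nonneg] half[OF near(2) vdist_nonneg] half[OF near(3) vdist_nonneg]
      Suc.prems by simp_all
  have "?d (p n) (q (Suc n)) \<le> ?d (p n) (q n) + ?d (q n) (q (Suc n))"
    by (rule vdist_triangle)
  also have "\<dots> < \<delta>" using near(1)[of n] near(3)[of n] Suc.prems by simp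
  finally have 2: "?d (p n) (q (Suc n)) < \<delta>" .
  have "g (p n) (p (Suc n)) + g (p (Suc n)) (q (Suc n)) = g (p n) (q (Suc n))"
    using Suc.prems X 1 2 by (intro local_cocycleD[OF g]) auto
  moreover have "g (p n) (q n) + g (q n) (q (Suc n)) = g (p n) (q (Suc n))"
    using Suc.prems X 1 2 by (intro local_cocycleD[OF g]) auto
  ultimately show ?case
    using Suc by (simp add: add.assoc) (metis add.assoc)
qed simp

text \<open>The ladder between two segments with common start \<open>c\<close>, whose first rung is
  trivial. The segments may run in different simplices. Steps have length at most 2 / N, so 4 / N <
  \<open>\<delta>\<close> is what the ladder asks for.\<close>

lemma chain_sum_near:
  assumes T: "finite_abs_complex T" and g: "local_cocycle T \<delta> g" and N: "0 < N" "4 / real N < \<delta>"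
    and X: "c \<in> realization T" "x \<in> realization T" "y \<in> realization T"
    and s: "s \<in> simplices T" "support c \<subseteq> s" "support x \<subseteq> s"
    and t: "t \<in> simplices T" "support c \<subseteq> t" "support y \<subseteq> t"
    and near: "vdist (verts T) x y < \<delta> / 2"
  shows "chain_sum g N c y = chain_sum g N c x + g x y"
proof -
  have step: "vdist (verts T) (segment_point N c z i) (segment_point N c z (Suc i)) < \<delta> / 2"
    if "z \<in> realization T" for z i
    using vdist_segment_step[OF T X(1) that N(1), of i] N(2) by (simp add: field_simps)
  have \<delta>: "0 < \<delta>" using N by (meson divide_nonneg_nonneg le_less_trans of_nat_0_le_iff zero_le_numeral)
  have "chain_sum g N c x + g (segment_point N c x N) (segment_point N c y N) =
      g (segment_point N c x 0) (segment_point N c y 0) + chain_sum g N c y"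
    unfolding chain_sum_def
  proof (rule ladder[OF g])
    show "segment_point N c x i \<in> realization T" if "i \<le> N" for i
      using segment_point_in_realization[OF T s(1) X(1,2) s(2,3) that N(1)] .
    show "segment_point N c y i \<in> realization T" if "i \<le> N" for i
      using segment_point_in_realization[OF T t(1) X(1,3) t(2,3) that N(1)] .
    show "vdist (verts T) (segment_point N c x i) (segment_point N c y i) < \<delta> / 2" if "i \<le> N" for i
      using vdist_segments[OF N(1) that, of "verts T" c x y] near by simp
  qed (use step X in auto)
  then show ?thesis using N local_cocycle_self[OF g X(1) \<delta>] by simp
qed

text \<open>A discrete Stokes theorem: the endpoint slides from \<open>x\<close> to \<open>y\<close>
  in small steps, and \<open>chain_sum_near\<close> accounts for each of them.\<close>

lemma chain_sum_triangle:
  assumes T: "finite_abs_complex T" and g: "local_cocycle T \<delta> g" and N: "0 < N" "4 / real N < \<delta>"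
    and X: "c \<in> realization T" "x \<in> realization T" "y \<in> realization T"
    and s: "s \<in> simplices T" "support c \<subseteq> s" "support x \<subseteq> s" "support y \<subseteq> s"
  shows "chain_sum g N c y = chain_sum g N c x + chain_sum g N x y"
proof -
  let ?r = "segment_point N x y"
  have r: "?r i \<in> realization T" "support (?r i) \<subseteq> s" if "i \<le> N" for i
    using segment_point_in_realization[OF T s(1) X(2,3) s(3,4) that N(1)]
      support_segment_point[OF s(3,4)] by auto
  have "chain_sum g N c (?r n) = chain_sum g N c x + (\<Sum>i<n. g (?r i) (?r (Suc i)))" if "n \<le> N" for n
    using that
  proof (induction n)
    case (Suc n)
    have "vdist (verts T) (?r n) (?r (Suc n)) < \<delta> / 2"
      using vdist_segment_step[OF T X(2,3) N(1), of n] N(2) by (simp add: field_simps)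
    then have "chain_sum g N c (?r (Suc n)) = chain_sum g N c (?r n) + g (?r n) (?r (Suc n))"
      using Suc.prems by (intro chain_sum_near[OF T g N X(1) r(1) r(1) s(1,2) r(2) s(1,2) r(2)]) auto
    then show ?case using Suc by (simp add: add.assoc)
  qed simp
  from this[of N] show ?thesis using N(1) by (simp add: chain_sum_def)
qed

lemma chain_sum_self:
  assumes "finite_abs_complex T" "local_cocycle T \<delta> g" "0 < \<delta>" "c \<in> realization T"
  shows "chain_sum g N c c = 0"
  using local_cocycle_self[OF assms(2,4,3)] by (simp add: chain_sum_def)

abbreviation vertex_point :: "'v \<Rightarrow> 'v \<Rightarrow> real" where
  "vertex_point v \<equiv> barycenter {v}"

lemma vertex_point:
  assumes "finite_abs_complex T" "v \<in> verts T"
  shows "vertex_point v \<in> realization T"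
  using assms barycenter_in_realization[OF assms(1), of "{v}"] by (auto simp: finite_abs_complex_def)

lemma support_vertex_point [simp]: "support (vertex_point v) = {v}"
  by (auto simp: barycenter_def)

text \<open>\<open>Min\<close> and \<open>Max\<close> only pick an orientation of the edge, on which the value does not depend.\<close>

definition edge_cochain ::
  "'v::linorder abs_complex \<Rightarrow> nat \<Rightarrow> (('v \<Rightarrow> real) \<Rightarrow> ('v \<Rightarrow> real) \<Rightarrow> bit) \<Rightarrow> 'v set \<Rightarrow> bit" where
  "edge_cochain T N g = (\<lambda>e. if e \<in> edges T
     then chain_sum g N (vertex_point (Min e)) (vertex_point (Max e)) else 0)"

text \<open>Going from \<open>u\<close> to \<open>v\<close> and back sums to 0 by
  \<open>chain_sum_triangle\<close>, so mod 2 both directions have the same value.\<close>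

lemma edge_cochain_pair:
  assumes T: "finite_abs_complex T" and g: "local_cocycle T \<delta> g" and N: "0 < N" "4 / real N < \<delta>"
    and s: "s \<in> simplices T" "u \<in> s" "v \<in> s"
  shows "edge_cochain T N g {u, v} = chain_sum g N (vertex_point u) (vertex_point v)"
proof -
  have \<delta>: "0 < \<delta>" using N by (meson divide_nonneg_nonneg le_less_trans of_nat_0_le_iff zero_le_numeral)
  have uv: "u \<in> verts T" "v \<in> verts T" using s simplex_subset_verts(1)[OF T s(1)] by auto
  note vp = vertex_point[OF T uv(1)] vertex_point[OF T uv(2)]
  note self = chain_sum_self[OF T g \<delta> vp(1)]
  show ?thesis
  proof (cases "u = v")
    case True
    then show ?thesis using self by (simp add: edge_cochain_def edges_def)
  next
    case False
    then have e: "{u, v} \<in> edges T"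
      using s simplex_mono[OF T s(1), of "{u, v}"] by (simp add: edges_def)
    have "chain_sum g N (vertex_point u) (vertex_point u) =
        chain_sum g N (vertex_point u) (vertex_point v) + chain_sum g N (vertex_point v) (vertex_point u)"
      using s by (intro chain_sum_triangle[OF T g N vp(1,2,1) s(1)]) auto
    then have "chain_sum g N (vertex_point u) (vertex_point v) = chain_sum g N (vertex_point v) (vertex_point u)"
      unfolding self
      by (cases "chain_sum g N (vertex_point u) (vertex_point v)";
          cases "chain_sum g N (vertex_point v) (vertex_point u)") simp_all
    then show ?thesis using e by (cases "u \<le> v") (simp_all add: edge_cochain_def min_def max_def)
  qed
qed

lemma edge_cochain_cocycle:
  assumes T: "finite_abs_complex T" and g: "local_cocycle T \<delta> g" and N: "0 < N" "4 / real N < \<delta>"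
  shows "edge_cochain T N g \<in> cocycles T"
proof -
  have "coboundary1 T (edge_cochain T N g) f = 0" for f
  proof (cases "f \<in> faces T")
    case True
    note f = faceD[OF True]
    obtain u v w where uvw: "f = {u, v, w}" "u \<noteq> v" "v \<noteq> w" "u \<noteq> w"
      using f(1) by (auto simp: card_3_iff)
    have "coboundary1 T (edge_cochain T N g) f =
        edge_cochain T N g {u, v} + (edge_cochain T N g {v, w} + edge_cochain T N g {u, w})"
      using coboundary1_triangle[OF T] True uvw by simp
    also have "\<dots> = (chain_sum g N (vertex_point u) (vertex_point v) +
        chain_sum g N (vertex_point v) (vertex_point w)) + chain_sum g N (vertex_point u) (vertex_point w)"
      using uvw f(2) by (simp add: edge_cochain_pair[OF T g N f(2)] add.assoc)
    also have "chain_sum g N (vertex_point u) (vertex_point v) +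
        chain_sum g N (vertex_point v) (vertex_point w) = chain_sum g N (vertex_point u) (vertex_point w)"
    proof (rule chain_sum_triangle[OF T g N _ _ _ f(2), symmetric])
      have "u \<in> verts T" "v \<in> verts T" "w \<in> verts T"
        using uvw simplex_subset_verts(1)[OF T f(2)] by auto
      then show "vertex_point u \<in> realization T" "vertex_point v \<in> realization T" "vertex_point w \<in> realization T"
        by (simp_all add: vertex_point[OF T])
    qed (use uvw in auto)
    finally show ?thesis by simp
  qed (simp add: coboundary1_def)
  then have "coboundary1 T (edge_cochain T N g) = 0" by (intro ext) simp
  then show ?thesis by (simp add: cocycles_def cochains_def edge_cochain_def)
qed

section \<open>Topological invariance of the Euler characteristic\<close>

lemma ex_mesh:
  fixes \<delta> c :: real
  assumes "0 < \<delta>"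
  shows "\<exists>N::nat. 0 < N \<and> c / real N < \<delta>"
proof -
  obtain N :: nat where "c / \<delta> < real N" using reals_Archimedean2 by blast
  then have "c < real (Suc N) * \<delta>" using assms by (simp add: pos_divide_less_eq algebra_simps)
  then have "c / real (Suc N) < \<delta>" by (simp add: pos_divide_less_eq mult.commute)
  then show ?thesis by blast
qed

text \<open>The primitive integrates \<open>g\<close> from a vertex in the support of the point,
  with \<open>h\<close> supplying the constant of integration. Any vertex of the support gives the
  same value, and nearby points have one in common, from which \<open>chain_sum_near\<close>
  compares them.\<close>

lemma local_coboundary_if_edge_cochain_coboundary:
  assumes T: "finite_abs_complex T" and g: "local_cocycle T \<delta> g" and N: "0 < N" "4 / real N < \<delta>"
    and cob: "edge_cochain T N g \<in> coboundaries T"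
  shows "\<exists>f. \<exists>\<eta>>0. \<forall>x\<in>realization T. \<forall>y\<in>realization T. vdist (verts T) x y < \<eta> \<longrightarrow> g x y = f x + f y"
proof -
  let ?n = "real (card (verts T))"
  have \<delta>: "0 < \<delta>" using N by (meson divide_nonneg_nonneg le_less_trans of_nat_0_le_iff zero_le_numeral)
  obtain h where h: "edge_cochain T N g = coboundary0 T h"
    using cob by (auto simp: coboundaries_def)
  have hsum: "chain_sum g N (vertex_point u) (vertex_point v) = h u + h v"
    if "s \<in> simplices T" "u \<in> s" "v \<in> s" for s u v
  proof (cases "u = v")
    case True
    have "u \<in> verts T" using that simplex_subset_verts(1)[OF T that(1)] by auto
    then show ?thesis using True chain_sum_self[OF T g \<delta> vertex_point[OF T]] by simp
  next
    case False
    then have "{u, v} \<in> edges T"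
      using that simplex_mono[OF T that(1), of "{u, v}"] by (simp add: edges_def)
    then have "edge_cochain T N g {u, v} = h u + h v"
      using False by (simp add: h coboundary0_def)
    then show ?thesis using edge_cochain_pair[OF T g N that] by simp
  qed
  define f where "f x = h (dominant T x) + chain_sum g N (vertex_point (dominant T x)) x" for x
  have f: "f x = h v + chain_sum g N (vertex_point v) x" if x: "x \<in> realization T" "v \<in> support x" for x v
  proof -
    let ?u = "dominant T x"
    note s = realizationD(2,3)[OF T x(1)]
    have u: "?u \<in> support x" by (rule dominant(3)[OF T x(1)])
    then have vp: "vertex_point v \<in> realization T" "vertex_point ?u \<in> realization T"
      using s(2) x(2) vertex_point[OF T] by blast+
    have "chain_sum g N (vertex_point v) x =
        chain_sum g N (vertex_point v) (vertex_point ?u) + chain_sum g N (vertex_point ?u) x"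
      using x u by (intro chain_sum_triangle[OF T g N vp x(1) s(1)]) simp_all
    then show ?thesis
      unfolding f_def hsum[OF s(1) x(2) u] by (cases "h v") simp_all
  qed
  show ?thesis
  proof (intro exI conjI ballI impI)
    \<comment> \<open>Without vertices \<open>1 / ?n\<close> would be 0; the value 1 only secures
      positivity, as there are then no points.\<close>
    show "0 < (if verts T = {} then 1 else min (\<delta> / 2) (1 / ?n))"
      using \<delta> T by (simp add: finite_abs_complex_def card_gt_0_iff)
    fix x y assume xy: "x \<in> realization T" "y \<in> realization T"
      and near: "vdist (verts T) x y < (if verts T = {} then 1 else min (\<delta> / 2) (1 / ?n))"
    let ?u = "dominant T x"
    have "verts T \<noteq> {}" using dominant(1)[OF T xy(1)] by auto
    then have near': "vdist (verts T) x y < \<delta> / 2" "vdist (verts T) x y < 1 / ?n" using near by auto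
    have u: "?u \<in> support x" "?u \<in> support y"
      using dominant(3)[OF T xy(1)] dominant_near[OF T xy near'(2)] by auto
    have "?u \<in> verts T" by (rule dominant(1)[OF T xy(1)])
    then have vp: "vertex_point ?u \<in> realization T" by (rule vertex_point[OF T])
    have "chain_sum g N (vertex_point ?u) y = chain_sum g N (vertex_point ?u) x + g x y"
      using u by (intro chain_sum_near[OF T g N vp xy realizationD(2)[OF T xy(1)] _ _ realizationD(2)[OF T xy(2)] _ _ near'(1)])
        simp_all
    then show "g x y = f x + f y"
      unfolding f[OF xy(1) u(1)] f[OF xy(2) u(2)]
      by (cases "h ?u"; cases "chain_sum g N (vertex_point ?u) x") simp_all
  qed
qed

text \<open>Along a finely subdivided edge the sum of \<open>spread T \<phi>\<close> is computed
  twice. The primitive telescopes to its values at the two ends; the cocycle identity inside the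
  edge telescopes to the value of \<open>\<phi>\<close> on it.\<close>

lemma coboundary_if_spread_local_coboundary:
  assumes T: "finite_abs_complex T" and \<phi>: "\<phi> \<in> cocycles T" and \<eta>: "0 < \<eta>"
    and f: "\<And>x y. x \<in> realization T \<Longrightarrow> y \<in> realization T \<Longrightarrow> vdist (verts T) x y < \<eta> \<Longrightarrow>
      spread T \<phi> x y = f x + f y"
  shows "\<phi> \<in> coboundaries T"
proof -
  define h where "h v = (if v \<in> verts T then f (vertex_point v) else 0)" for v
  have "\<phi> e = coboundary0 T h e" for e
  proof (cases "e \<in> edges T")
    case False
    then show ?thesis using \<phi> by (simp add: coboundary0_def cocycles_def cochains_def)
  next
    case True
    then obtain u v where e: "e = {u, v}" "u \<noteq> v" using edgeD(1) by (metis card_2_iff)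
    then have s: "{u, v} \<in> simplices T" using edgeD(2)[OF True] by simp
    have uv: "u \<in> verts T" "v \<in> verts T" using simplex_subset_verts(1)[OF T s] by auto
    obtain N :: nat where N: "0 < N" "2 / real N < \<eta>" using ex_mesh[OF \<eta>] by blast
    let ?p = "segment_point N (vertex_point u) (vertex_point v)"
    have p: "?p i \<in> realization T" "support (?p i) \<subseteq> {u, v}" if "i \<le> N" for i
      using segment_point_in_realization[OF T s vertex_point[OF T uv(1)] vertex_point[OF T uv(2)] _ _ that N(1)]
        support_segment_point[of "vertex_point u" "{u, v}" "vertex_point v"] by auto
    have d: "dominant T (?p i) \<in> {u, v}" if "i \<le> N" for i
      using dominant(3)[OF T p(1)[OF that]] p(2)[OF that] by blast
    have ends: "dominant T (?p 0) = u" "dominant T (?p N) = v"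
      using dominant(3)[OF T p(1)[of 0]] dominant(3)[OF T p(1)[of N]] N by simp_all
    have "(\<Sum>i<n. spread T \<phi> (?p i) (?p (Suc i))) = f (?p 0) + f (?p n)" if "n \<le> N" for n
      using that
    proof (induction n)
      case (Suc n)
      have "spread T \<phi> (?p n) (?p (Suc n)) = f (?p n) + f (?p (Suc n))"
        using Suc.prems vdist_segment_step[OF T vertex_point[OF T uv(1)] vertex_point[OF T uv(2)] N(1), of n] N(2)
        by (intro f p) simp_all
      then show ?case using Suc by (cases "f (?p n)") simp_all
    qed simp
    moreover have "(\<Sum>i<n. spread T \<phi> (?p i) (?p (Suc i))) = \<phi> {dominant T (?p 0), dominant T (?p n)}"
      if "n \<le> N" for n
      using that
    proof (induction n)
      case 0
      then show ?case using \<phi> by (simp add: cocycles_def cochains_def edges_def)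
    next
      case (Suc n)
      then show ?case
        using cocycle_triangle[OF T \<phi> s d[of 0] d[of n] d[of "Suc n"]] by (simp add: spread_def)
    qed
    ultimately have "\<phi> {dominant T (?p 0), dominant T (?p N)} = f (?p 0) + f (?p N)"
      by simp
    then have "\<phi> {u, v} = f (vertex_point u) + f (vertex_point v)"
      unfolding ends using N by simp
    then show ?thesis using True e uv by (simp add: coboundary0_def h_def)
  qed
  then have "\<phi> = coboundary0 T h" by blast
  moreover have "h \<in> cochains (verts T)" by (simp add: cochains_def h_def)
  ultimately show ?thesis by (auto simp: coboundaries_def)
qed

lemma coboundary1_coboundary0:
  assumes T: "finite_abs_complex T"
  shows "coboundary1 T (coboundary0 T h) = 0"
proof
  fix f show "coboundary1 T (coboundary0 T h) f = 0 f"
  proof (cases "f \<in> faces T")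
    case True
    obtain u v w where uvw: "f = {u, v, w}" "u \<noteq> v" "v \<noteq> w" "u \<noteq> w"
      using faceD(1)[OF True] by (auto simp: card_3_iff)
    have "{u, v} \<in> edges T" "{v, w} \<in> edges T" "{u, w} \<in> edges T"
      using uvw simplex_mono[OF T faceD(2)[OF True]] by (simp_all add: edges_def)
    then show ?thesis
      using coboundary1_triangle[OF T True[unfolded uvw(1)] uvw(2-4), of "coboundary0 T h"] uvw
      by (cases "h u"; cases "h v"; cases "h w") (simp_all add: coboundary0_def)
  qed (simp add: coboundary1_def)
qed

lemma coboundaries_subset_cocycles:
  assumes "finite_abs_complex T"
  shows "coboundaries T \<subseteq> cocycles T"
  using coboundary1_coboundary0[OF assms]
  by (auto simp: coboundaries_def cocycles_def cochains_def coboundary0_def)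

lemma cocycles_diff: "\<phi> \<in> cocycles T \<Longrightarrow> \<psi> \<in> cocycles T \<Longrightarrow> \<phi> - \<psi> \<in> cocycles T"
  unfolding cocycles_def by (simp add: cochains_diff coboundary1_diff)

lemma coboundaries_diff:
  assumes "\<phi> \<in> coboundaries T" "\<psi> \<in> coboundaries T"
  shows "\<phi> - \<psi> \<in> coboundaries T"
proof -
  obtain g h where gh: "\<phi> = coboundary0 T g" "\<psi> = coboundary0 T h"
    "g \<in> cochains (verts T)" "h \<in> cochains (verts T)"
    using assms by (auto simp: coboundaries_def)
  then have "\<phi> - \<psi> = coboundary0 T (g - h)" by (simp only: coboundary0_diff)
  then show ?thesis using cochains_diff[OF gh(3,4)] by (simp only: coboundaries_def image_eqI)
qed

lemma finite_cocycles:
  assumes "finite_abs_complex T"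
  shows "finite (cocycles T)"
  using card_cochains(1)[OF finite_simplices(3)[OF assms]] by (simp add: cocycles_def)

text \<open>\<open>|H\<^sup>1(T)| \<le> |H\<^sup>1(T')|\<close> with denominators cleared.\<close>

lemma card_cohomology_le:
  fixes T T' :: "nat abs_complex"
  assumes T: "finite_abs_complex T" and T': "finite_abs_complex T'"
    and ne: "verts T \<noteq> {}"
    and compact: "compact (realization T)" "compact (realization T')"
    and hom: "homeomorphism (realization T) (realization T') h k"
  shows "card (cocycles T) * card (coboundaries T') \<le> card (cocycles T') * card (coboundaries T)"
proof -
  have fin: "finite (verts T)" "finite (verts T')" using T T' by (auto simp: finite_abs_complex_def)
  have h: "h x \<in> realization T'" "k (h x) = x" if "x \<in> realization T" for x
    using hom that by (auto simp: homeomorphism_def)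
  have k: "k x \<in> realization T" if "x \<in> realization T'" for x
    using hom that by (auto simp: homeomorphism_def)
  have "0 < 1 / real (card (verts T))" using ne fin by (simp add: card_gt_0_iff)
  \<comment> \<open>The target distance is the scale at which \<open>spread T \<phi>\<close>
    satisfies the cocycle identity.\<close>
  then obtain \<delta> where \<delta>: "0 < \<delta>" "\<And>x y. x \<in> realization T' \<Longrightarrow> y \<in> realization T' \<Longrightarrow>
      vdist (verts T') x y < \<delta> \<Longrightarrow> vdist (verts T) (k x) (k y) < 1 / real (card (verts T))"
    using uniformly_continuous_vdist[OF compact(2) homeomorphism_cont2[OF hom] fin(2) realizationD(3)[OF T'] fin(1)]
    by metis
  obtain N :: nat where N: "0 < N" "4 / real N < \<delta>" using ex_mesh[OF \<delta>(1)] by blast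
  define \<Psi> where "\<Psi> \<phi> = edge_cochain T' N (\<lambda>x y. spread T \<phi> (k x) (k y))" for \<phi>
  have loc: "local_cocycle T' \<delta> (\<lambda>x y. spread T \<phi> (k x) (k y))" if "\<phi> \<in> cocycles T" for \<phi>
    unfolding local_cocycle_def
    by (intro ballI impI local_cocycleD[OF local_cocycle_spread[OF T that]] k \<delta>(2))
  have \<Psi>_cocycle: "\<Psi> \<phi> \<in> cocycles T'" if "\<phi> \<in> cocycles T" for \<phi>
    unfolding \<Psi>_def by (rule edge_cochain_cocycle[OF T' loc[OF that] N])
  have \<Psi>_diff: "\<Psi> (\<phi> - \<psi>) = \<Psi> \<phi> - \<Psi> \<psi>" for \<phi> \<psi>
    by (rule ext) (simp add: \<Psi>_def edge_cochain_def chain_sum_def spread_def sum.distrib)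
  \<comment> \<open>Injectivity on cohomology: a primitive found on \<open>realization T'\<close> is
    pulled back along \<open>h\<close>.\<close>
  have \<Psi>_coboundary: "\<phi> \<in> coboundaries T" if \<phi>: "\<phi> \<in> cocycles T" "\<Psi> \<phi> \<in> coboundaries T'" for \<phi>
  proof -
    obtain f \<eta> where \<eta>: "0 < \<eta>" and f: "\<And>x y. x \<in> realization T' \<Longrightarrow> y \<in> realization T' \<Longrightarrow>
        vdist (verts T') x y < \<eta> \<Longrightarrow> spread T \<phi> (k x) (k y) = f x + f y"
      using local_coboundary_if_edge_cochain_coboundary[OF T' loc[OF \<phi>(1)] N] \<phi>(2)
      unfolding \<Psi>_def by blast
    obtain \<zeta> where \<zeta>: "0 < \<zeta>" "\<And>x y. x \<in> realization T \<Longrightarrow> y \<in> realization T \<Longrightarrow>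
        vdist (verts T) x y < \<zeta> \<Longrightarrow> vdist (verts T') (h x) (h y) < \<eta>"
      using uniformly_continuous_vdist[OF compact(1) homeomorphism_cont1[OF hom] fin(1) realizationD(3)[OF T] fin(2) \<eta>]
      by metis
    show ?thesis
    proof (rule coboundary_if_spread_local_coboundary[OF T \<phi>(1) \<zeta>(1)])
      fix x y assume xy: "x \<in> realization T" "y \<in> realization T" "vdist (verts T) x y < \<zeta>"
      then have "spread T \<phi> (k (h x)) (k (h y)) = f (h x) + f (h y)"
        by (intro f h \<zeta>(2))
      then show "spread T \<phi> x y = f (h x) + f (h y)" using xy h by simp
    qed
  qed
  \<comment> \<open>The kernel of \<open>?F\<close> projects injectively to the coboundaries of
    \<open>T\<close>, by \<open>\<Psi>_coboundary\<close>, and the image lies in the cocycles of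
    \<open>T'\<close>. This compares the quotient groups without forming them.\<close>
  let ?A = "cocycles T \<times> coboundaries T'" and ?F = "\<lambda>(\<phi>, b). \<Psi> \<phi> - b"
  have finB: "finite (coboundaries T')" "finite (coboundaries T)"
    using finite_cocycles T T' coboundaries_subset_cocycles by (meson finite_subset)+
  have "card ?A = card {x \<in> ?A. ?F x = 0} * card (?F ` ?A)"
  proof (rule card_eq_kernel_times_image)
    show "finite ?A" using finite_cocycles[OF T] finB by simp
    show "x - y \<in> ?A" if "x \<in> ?A" "y \<in> ?A" for x y
      using that cocycles_diff coboundaries_diff by (auto simp: minus_prod_def)
    show "?F (x - y) = ?F x - ?F y" for x y
      by (simp add: minus_prod_def \<Psi>_diff split: prod.split)
  qed
  moreover have "card {x \<in> ?A. ?F x = 0} \<le> card (coboundaries T)"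
  proof (rule card_inj_on_le[where f = fst])
    show "inj_on fst {x \<in> ?A. ?F x = 0}" by (auto simp: inj_on_def)
    show "fst ` {x \<in> ?A. ?F x = 0} \<subseteq> coboundaries T" using \<Psi>_coboundary by auto
  qed (rule finB)
  moreover have "card (?F ` ?A) \<le> card (cocycles T')"
  proof (rule card_mono[OF finite_cocycles[OF T']])
    have "\<Psi> \<phi> - b \<in> cocycles T'" if "\<phi> \<in> cocycles T" "b \<in> coboundaries T'" for \<phi> b
      using that coboundaries_subset_cocycles[OF T'] by (intro cocycles_diff \<Psi>_cocycle) blast+
    then show "?F ` ?A \<subseteq> cocycles T'" by (simp add: image_subset_iff split_beta mem_Times_iff)
  qed
  ultimately have "card ?A \<le> card (coboundaries T) * card (cocycles T')"
    by (simp only: mult_le_mono)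
  then show ?thesis by (simp add: card_cartesian_product mult.commute)
qed

text \<open>In exponents of 2, \<open>card_cohomology_le\<close> reads (|E| + 1 - |F|) + (|V'| - 1)
  <= (|E'| + 1 - |F'|) + (|V| - 1).\<close>

lemma euler_char_ge:
  fixes T T' :: "nat abs_complex"
  assumes T: "finite_abs_complex T" and T': "finite_abs_complex T'"
    and ne: "verts T \<noteq> {}" "verts T' \<noteq> {}"
    and compact: "compact (realization T)" "compact (realization T')"
    and conn: "connected (realization T)" "connected (realization T')"
    and plane: "locally_planar (realization T)" "locally_planar (realization T')"
    and hom: "homeomorphism (realization T) (realization T') h k"
  shows "complex_euler_char T' \<le> complex_euler_char T"
proof -
  let ?z = "card (cocycles T)" and ?z' = "card (cocycles T')"
  let ?b = "card (coboundaries T)" and ?b' = "card (coboundaries T')"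
  let ?V = "card (verts T)" and ?V' = "card (verts T')"
  let ?E = "card (edges T)" and ?E' = "card (edges T')"
  let ?F = "card (faces T)" and ?F' = "card (faces T')"
  have z: "?z * 2 ^ ?F = 2 * 2 ^ ?E" "?z' * 2 ^ ?F' = 2 * 2 ^ ?E'"
    using card_cocycles T T' ne conn plane by blast+
  have b: "2 * ?b = 2 ^ ?V" "2 * ?b' = 2 ^ ?V'"
    using card_coboundaries T T' ne conn by blast+
  have "(2::nat) * 2 ^ (?E + ?V' + ?F') = (?z * 2 ^ ?F) * (2 * ?b') * 2 ^ ?F'"
    unfolding z b by (simp add: power_add)
  also have "\<dots> = (?z * ?b') * (2 * 2 ^ ?F * 2 ^ ?F')" by (simp add: mult_ac)
  also have "\<dots> \<le> (?z' * ?b) * (2 * 2 ^ ?F * 2 ^ ?F')"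
    using card_cohomology_le[OF T T' ne(1) compact hom] by (rule mult_le_mono1)
  also have "\<dots> = (?z' * 2 ^ ?F') * (2 * ?b) * 2 ^ ?F" by (simp add: mult_ac)
  also have "\<dots> = 2 * 2 ^ (?E' + ?V + ?F)"
    unfolding z b by (simp add: power_add)
  finally have "(2::nat) ^ (?E + ?V' + ?F') \<le> 2 ^ (?E' + ?V + ?F)" by simp
  then have "?E + ?V' + ?F' \<le> ?E' + ?V + ?F"
    by (simp add: power_increasing_iff)
  then show ?thesis by (simp add: complex_euler_char_def)
qed


section \<open>Independence of the triangulation and of the vertex type\<close>

lemma homeomorphic_maps_imp_homeomorphism:
  assumes "homeomorphic_maps (top_of_set X) (top_of_set Y) h k"
  shows "homeomorphism X Y h k"
proof -
  have "continuous_on X h" "h \<in> X \<rightarrow> Y" "continuous_on Y k" "k \<in> Y \<rightarrow> X"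
    "\<forall>x\<in>X. k (h x) = x" "\<forall>y\<in>Y. h (k y) = y"
    using assms unfolding homeomorphic_maps_def continuous_map_subtopology_eu by simp_all
  then show ?thesis by (intro homeomorphismI) (simp_all add: image_subset_iff_funcset)
qed

lemma triangulation_realization:
  assumes M: "closed_two_manifold M" "connected_space M" and T: "triangulates T M"
  shows "finite_abs_complex T" "compact (realization T)" "connected (realization T)"
    "locally_planar (realization T)"
proof -
  show "finite_abs_complex T" using T by (simp add: triangulates_def)
  have hom: "top_of_set (realization T) homeomorphic_space M"
    using T by (simp add: triangulates_def geom_realization_eq)
  have "compact_space (top_of_set (realization T))"
    using homeomorphic_compact_space[OF hom] M(1) by (simp add: closed_two_manifold_def)
  then show "compact (realization T)"
    by (metis compactin_euclidean_iff compactin_subspace topspace_euclidean top_greatest)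
  have "connected_space (top_of_set (realization T))"
    using homeomorphic_connected_space[OF hom] M(2) by simp
  then show "connected (realization T)"
    by (simp add: connectedin_def flip: connectedin_iff_connected)
  show "locally_planar (realization T)"
    using locally_planar_if_two_manifold[OF hom] M(1) by (simp add: closed_two_manifold_def)
qed

lemma triangulation_euler_char_unique:
  fixes T T' :: "nat abs_complex"
  assumes M: "closed_two_manifold M" "connected_space M"
    and T: "triangulates T M" and T': "triangulates T' M"
  shows "complex_euler_char T = complex_euler_char T'"
proof -
  note R = triangulation_realization[OF M T] and R' = triangulation_realization[OF M T']
  have "top_of_set (realization T) homeomorphic_space top_of_set (realization T')"
    using T T' homeomorphic_space_sym homeomorphic_space_trans
    unfolding triangulates_def geom_realization_eq by blast
  then obtain h k where "homeomorphic_maps (top_of_set (realization T)) (top_of_set (realization T')) h k"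
    by (auto simp: homeomorphic_space_def)
  then have hom: "homeomorphism (realization T) (realization T') h k"
    by (rule homeomorphic_maps_imp_homeomorphism)
  \<comment> \<open>The empty space counts as connected and has empty triangulations, to which the
    cochain counts do not apply.\<close>
  have verts_empty: "verts S = {} \<longleftrightarrow> realization S = {}" if S: "finite_abs_complex S" for S :: "nat abs_complex"
    using vertex_point[OF S] realizationD(3,6)[OF S] by blast
  have euler0: "complex_euler_char S = 0" if S: "finite_abs_complex S" "verts S = {}" for S :: "nat abs_complex"
  proof -
    have "s = {}" if "s \<in> simplices S" for s
      using simplex_subset_verts(1)[OF S(1) that] S(2) by simp
    then have "edges S = {}" "faces S = {}" by (force simp: edges_def faces_def)+
    then show ?thesis using S(2) by (simp add: complex_euler_char_def)
  qed
  show ?thesis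
  proof (cases "verts T = {}")
    case True
    then have "realization T' = {}"
      using verts_empty[OF R(1)] hom by (auto simp: homeomorphism_def)
    then show ?thesis using True verts_empty[OF R'(1)] euler0[OF R(1)] euler0[OF R'(1)] by simp
  next
    case False
    then have False': "verts T' \<noteq> {}"
      using verts_empty[OF R(1)] verts_empty[OF R'(1)] hom by (auto simp: homeomorphism_def)
    show ?thesis
      using euler_char_ge[OF R(1) R'(1) False False' R(2) R'(2) R(3) R'(3) R(4) R'(4) hom]
        euler_char_ge[OF R'(1) R(1) False' False R'(2) R(2) R'(3) R(3) R'(4) R(4) homeomorphism_symD[OF hom]]
      by simp
  qed
qed

text \<open>\<open>euler_char\<close> ranges over complexes on \<open>nat\<close>, and the
  comparison of cohomology uses the order of \<open>nat\<close> and the metric on functions from it.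
  Relabelling along an injection brings in all other vertex types.\<close>

definition relabel :: "('v \<Rightarrow> 'w) \<Rightarrow> 'v abs_complex \<Rightarrow> 'w abs_complex" where
  "relabel \<iota> T = \<lparr>verts = \<iota> ` verts T, simplices = (`) \<iota> ` simplices T\<rparr>"

lemma complex_euler_char_relabel:
  assumes T: "finite_abs_complex T" and \<iota>: "inj_on \<iota> (verts T)"
  shows "complex_euler_char (relabel \<iota> T) = complex_euler_char T"
proof -
  have card: "card (\<iota> ` s) = card s" if "s \<in> simplices T" for s
    using simplex_subset_verts(1)[OF T that] \<iota> by (meson card_image inj_on_subset)
  have inj: "inj_on ((`) \<iota>) S" if "S \<subseteq> simplices T" for S
    using inj_on_image_Pow[OF \<iota>] that simplex_subset_verts(1)[OF T]
    by (meson PowI inj_on_subset subset_iff)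
  have "edges (relabel \<iota> T) = (`) \<iota> ` edges T" "faces (relabel \<iota> T) = (`) \<iota> ` faces T"
    using card by (auto simp: edges_def faces_def relabel_def)
  moreover have "edges T \<subseteq> simplices T" "faces T \<subseteq> simplices T"
    by (auto simp: edges_def faces_def)
  ultimately show ?thesis
    using \<iota> inj by (simp add: complex_euler_char_def card_image relabel_def)
qed

lemma finite_abs_complex_relabel:
  assumes T: "finite_abs_complex T"
  shows "finite_abs_complex (relabel \<iota> T)"
  unfolding finite_abs_complex_def
proof (intro conjI ballI allI impI)
  show "finite (verts (relabel \<iota> T))" using T by (simp add: relabel_def finite_abs_complex_def)
  show "{w} \<in> simplices (relabel \<iota> T)" if "w \<in> verts (relabel \<iota> T)" for w
  proof -
    obtain v where "v \<in> verts T" "w = \<iota> v" using \<open>w \<in> verts (relabel \<iota> T)\<close> by (auto simp: relabel_def)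
    then have "{v} \<in> simplices T" "{w} = \<iota> ` {v}" using T by (auto simp: finite_abs_complex_def)
    then show ?thesis by (auto simp: relabel_def)
  qed
  fix s assume "s \<in> simplices (relabel \<iota> T)"
  then obtain t where t: "t \<in> simplices T" "s = \<iota> ` t" by (auto simp: relabel_def)
  show "s \<subseteq> verts (relabel \<iota> T)"
    using t simplex_subset_verts(1)[OF T t(1)] by (auto simp: relabel_def)
  fix r assume "r \<subseteq> s"
  then obtain q where "q \<subseteq> t" "r = \<iota> ` q" using t by (auto simp: subset_image_iff)
  then show "r \<in> simplices (relabel \<iota> T)"
    using simplex_mono[OF T t(1)] by (auto simp: relabel_def)
qed

text \<open>\<open>F\<close> and \<open>G\<close> rename coordinates and fill in 0 elsewhere, so
  each coordinate of either map is a projection or constant.\<close>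

lemma geom_realization_relabel:
  assumes T: "finite_abs_complex T" and \<iota>: "inj_on \<iota> (verts T)"
  shows "geom_realization T homeomorphic_space geom_realization (relabel \<iota> T)"
proof -
  let ?V = "verts T"
  define F where "F x w = (if w \<in> \<iota> ` ?V then x (inv_into ?V \<iota> w) else 0)" for x :: "'a \<Rightarrow> real" and w
  define G where "G y v = (if v \<in> ?V then y (\<iota> v) else 0)" for y :: "'b \<Rightarrow> real" and v
  have T': "finite_abs_complex (relabel \<iota> T)" by (rule finite_abs_complex_relabel[OF T])
  have F\<iota>: "F x (\<iota> v) = x v" if "v \<in> ?V" for x v
    using that \<iota> by (simp add: F_def)
  have GF: "G (F x) = x" if "x \<in> realization T" for x
    using realizationD(3)[OF T that] F\<iota> by (auto simp: G_def fun_eq_iff)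
  have FG: "F (G y) = y" if "y \<in> realization (relabel \<iota> T)" for y
  proof
    fix w
    show "F (G y) w = y w"
    proof (cases "w \<in> \<iota> ` ?V")
      case True
      then show ?thesis using F\<iota> by (auto simp: G_def)
    next
      case False
      then show ?thesis using realizationD(3)[OF T' that] by (auto simp: F_def relabel_def)
    qed
  qed
  have FX: "F x \<in> realization (relabel \<iota> T)" if x: "x \<in> realization T" for x
  proof -
    note D = realizationD[OF T x]
    have "support (F x) = \<iota> ` support x"
    proof (intro equalityI subsetI)
      fix w assume "w \<in> support (F x)"
      then have "F x w \<noteq> 0" "w \<in> \<iota> ` ?V" by (auto simp: F_def split: if_splits)
      then obtain v where "v \<in> ?V" "w = \<iota> v" "x v \<noteq> 0" using F\<iota> by auto
      then show "w \<in> \<iota> ` support x" by blast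
    next
      fix w assume "w \<in> \<iota> ` support x"
      then show "w \<in> support (F x)" using D(3) F\<iota> by auto
    qed
    moreover have "sum (F x) (\<iota> ` ?V) = sum x ?V"
      using \<iota> F\<iota> by (simp add: sum.reindex)
    ultimately show ?thesis
      using D by (simp add: realization_def relabel_def F_def)
  qed
  have GX: "G y \<in> realization T" if y: "y \<in> realization (relabel \<iota> T)" for y
  proof -
    note D = realizationD[OF T' y]
    obtain s where s: "s \<in> simplices T" "support y = \<iota> ` s"
      using D(2) by (auto simp: relabel_def)
    have sV: "s \<subseteq> ?V" by (rule simplex_subset_verts(1)[OF T s(1)])
    have "support (G y) = s"
    proof (intro equalityI subsetI)
      fix v assume "v \<in> support (G y)"
      then have v: "v \<in> ?V" "\<iota> v \<in> \<iota> ` s" using s(2) by (auto simp: G_def split: if_splits)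
      then show "v \<in> s" using sV \<iota> by (auto dest: inj_onD)
    next
      fix v assume v: "v \<in> s"
      then have "\<iota> v \<in> support y" using s(2) by blast
      then show "v \<in> support (G y)" using v sV by (auto simp: G_def)
    qed
    moreover have "sum (G y) ?V = sum y (\<iota> ` ?V)"
      using \<iota> by (simp add: sum.reindex G_def)
    ultimately show ?thesis
      using D s by (simp add: realization_def relabel_def G_def)
  qed
  have "continuous_on UNIV F"
  proof (rule continuous_on_coordinatewise_then_product)
    show "continuous_on UNIV (\<lambda>x. F x w)" for w
      by (cases "w \<in> \<iota> ` ?V") (simp_all add: F_def)
  qed
  moreover have "continuous_on UNIV G"
  proof (rule continuous_on_coordinatewise_then_product)
    show "continuous_on UNIV (\<lambda>y. G y v)" for v
      by (cases "v \<in> ?V") (simp_all add: G_def)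
  qed
  ultimately have "homeomorphic_maps (top_of_set (realization T)) (top_of_set (realization (relabel \<iota> T))) F G"
    using FX GX GF FG
    by (auto simp: homeomorphic_maps_def continuous_map_in_subtopology intro: continuous_on_subset)
  then show ?thesis
    unfolding geom_realization_eq homeomorphic_space_def by blast
qed

lemma euler_char_eq_complex_euler_char:
  assumes M: "closed_two_manifold M" "connected_space M" and T: "triangulates T M"
  shows "euler_char M = complex_euler_char T"
proof -
  have fin: "finite_abs_complex T" using T by (simp add: triangulates_def)
  then have "finite (verts T)" by (simp add: finite_abs_complex_def)
  then obtain \<iota> :: "_ \<Rightarrow> nat" where \<iota>: "inj_on \<iota> (verts T)"
    using finite_imp_inj_to_nat_seg by metis
  have nat: "triangulates (relabel \<iota> T) M"
    using T finite_abs_complex_relabel[OF fin] geom_realization_relabel[OF fin \<iota>]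
      homeomorphic_space_sym homeomorphic_space_trans
    unfolding triangulates_def by blast
  have "euler_char M = complex_euler_char (relabel \<iota> T)"
    unfolding euler_char_def
  proof (rule the_equality)
    show "\<exists>T' :: nat abs_complex. triangulates T' M \<and> complex_euler_char T' = complex_euler_char (relabel \<iota> T)"
      using nat by blast
    fix c assume "\<exists>T' :: nat abs_complex. triangulates T' M \<and> complex_euler_char T' = c"
    then obtain T' :: "nat abs_complex" where "triangulates T' M" "complex_euler_char T' = c" by blast
    then show "c = complex_euler_char (relabel \<iota> T)"
      using triangulation_euler_char_unique[OF M _ nat] by simp
  qed
  then show ?thesis using complex_euler_char_relabel[OF fin \<iota>] by simp
qed

theorem theorem1:
  fixes M :: "'a topology"
  assumes "closed_two_manifold M" and "connected_space M"
  shows "\<exists>C :: int.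
           C = (let K = 18 * (1 + \<bar>euler_char M\<bar>) in K^2 + 3 * K) \<and>
           (\<forall>T :: 'v abs_complex. triangulates T M \<longrightarrow>
              int (cyclic_chromatic_number T) \<le> int (card (verts T)) + C)"
proof (intro exI conjI allI impI)
  fix T :: "'v abs_complex" assume T: "triangulates T M"
  note R = triangulation_realization[OF assms T]
  define K where "K = 18 * (1 + \<bar>euler_char M\<bar>)"
  have "int (cyclic_chromatic_number T) \<le> int (card (verts T)) + 9 + \<bar>euler_char M\<bar>"
    using cyclic_chromatic_number_le[OF R(1) two_faced_if_locally_planar[OF R(1,4)]]
      euler_char_eq_complex_euler_char[OF assms T] by simp
  \<comment> \<open>The linear term \<open>3 * K\<close>, which is 54 + 54 |chi|, already
    dominates.\<close>
  moreover have "9 + \<bar>euler_char M\<bar> \<le> 3 * K" by (simp add: K_def)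
  moreover have "0 \<le> K^2" by simp
  ultimately have "int (cyclic_chromatic_number T) \<le> int (card (verts T)) + (K^2 + 3 * K)"
    by linarith
  then show "int (cyclic_chromatic_number T) \<le> int (card (verts T)) +
      (let K = 18 * (1 + \<bar>euler_char M\<bar>) in K^2 + 3 * K)"
    unfolding K_def Let_def .
qed (rule refl)

end
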